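(* Let $(\mathbb{X},d,\mu)$ be a space of homogeneous type and let $\varphi:[0,\infty)\to[0,\infty)$ be an increasing, continuous, concave function with $\varphi(0)=0$ and $\lim_{t\to\infty}\varphi(t)=+\infty$. Then $\mathrm{BMO}(\mathbb{X})=\mathrm{BMO}_\varphi(\mathbb{X})$ as classes of measurable functions on $\mathbb X$, and there is a finite constant $c_{\varphi,\mu}$, depending on $\varphi$ and $\mu$ but not on $f$, such that for every measurable $f:\mathbb{X}\to\mathbb{R}$, $$\varphi^{-1}(1)\,\|f\|_{\mathrm{BMO}_\varphi(\mathbb{X})}\le\|f\|_{\mathrm{BMO}(\mathbb{X})}\le c_{\varphi,\mu}\,\|f\|_{\mathrm{BMO}_\varphi(\mathbb{X})}.$$
   Context: A space of homogeneous type $(\mathbb{X},d,\mu)$ is a set $\mathbb X$ with a quasi-metric $d$ and a doubling measure $\mu$. Here $d$ satisfies all the axioms of a distance except that the triangle inequality is replaced by $d(x,y)\le\kappa\,(d(x,z)+d(z,y))$ for all $x,y,z\in\mathbb X$, with a constant $\kappa\ge1$. $\mu$ is a Borel measure (for the topology induced by $d$) for which the open balls $B(x,r)=\{y:d(x,y)<r\}$ are measurable with $0<\mu(B(x,r))<\infty$, and there is $c_\mu>0$ with $\mu(B(x,2r))\le c_\mu\,\mu(B(x,r))$ for all $x\in\mathbb{X}$, $r>0$. Write $\frac{1}{\mu(B)}\int_B g\,d\mu$ for averages over balls $B$. Define $$\|f\|_{\mathrm{BMO}(\mathbb{X})}=\sup_B\inf_{c\in\mathbb{R}}\frac1{\mu(B)}\int_B|f-c|\,d\mu,$$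 $$\|f\|_{\mathrm{BMO}_\varphi(\mathbb{X})}=\sup_B\inf_{c\in\mathbb{R}}\inf\Big\{\lambda>0:\ \frac1{\mu(B)}\int_B\varphi\Big(\frac{|f(x)-c|}{\lambda}\Big)d\mu(x)\le1\Big\},$$ with suprema over all balls $B\subset\mathbb{X}$ (and $\inf\emptyset=\infty$). $\mathrm{BMO}(\mathbb X)$ and $\mathrm{BMO}_\varphi(\mathbb X)$ are the classes of measurable functions for which the respective quantity is finite. $\varphi^{-1}$ denotes the inverse function of $\varphi$. *)

theory Defs
  imports "HOL-Analysis.Analysis"
begin

definition quasi_metric_on :: "'a set \<Rightarrow> ('a \<Rightarrow> 'a \<Rightarrow> real) \<Rightarrow> bool" where
  "quasi_metric_on X d \<longleftrightarrow>
     (\<forall>x\<in>X. \<forall>y\<in>X. 0 \<le> d x y) \<and>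
     (\<forall>x\<in>X. \<forall>y\<in>X. d x y = 0 \<longleftrightarrow> x = y) \<and>
     (\<forall>x\<in>X. \<forall>y\<in>X. d x y = d y x) \<and>
     (\<exists>\<kappa>\<ge>1. \<forall>x\<in>X. \<forall>y\<in>X. \<forall>z\<in>X. d x y \<le> \<kappa> * (d x z + d z y))"

definition qball :: "'a set \<Rightarrow> ('a \<Rightarrow> 'a \<Rightarrow> real) \<Rightarrow> 'a \<Rightarrow> real \<Rightarrow> 'a set" where
  "qball X d x r = {y \<in> X. d x y < r}"

definition qballs :: "'a set \<Rightarrow> ('a \<Rightarrow> 'a \<Rightarrow> real) \<Rightarrow> 'a set set" where
  "qballs X d = {qball X d x r | x r. x \<in> X \<and> 0 < r}"

text \<open>The balls of a quasi-metric need not themselves be open in the topology it induces.\<close>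

definition qtopology :: "'a set \<Rightarrow> ('a \<Rightarrow> 'a \<Rightarrow> real) \<Rightarrow> 'a topology" where
  "qtopology X d = topology (\<lambda>U. U \<subseteq> X \<and> (\<forall>x\<in>U. \<exists>r>0. qball X d x r \<subseteq> U))"

lemma openin_qtopology:
  "openin (qtopology X d) U \<longleftrightarrow> U \<subseteq> X \<and> (\<forall>x\<in>U. \<exists>r>0. qball X d x r \<subseteq> U)"
proof -
  let ?P = "\<lambda>U. U \<subseteq> X \<and> (\<forall>x\<in>U. \<exists>r>0. qball X d x r \<subseteq> U)"
  have inter: "?P (S \<inter> T)" if S: "?P S" and T: "?P T" for S T
  proof (intro conjI ballI)
    show "S \<inter> T \<subseteq> X" using S by (simp add: le_infI1)
  next
    fix x assume x: "x \<in> S \<inter> T"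
    obtain r where r: "r > 0" "qball X d x r \<subseteq> S"
      using S x by (meson IntD1)
    obtain s where s: "s > 0" "qball X d x s \<subseteq> T"
      using T x by (meson IntD2)
    have "qball X d x (min r s) \<subseteq> qball X d x r \<inter> qball X d x s"
      unfolding qball_def by fastforce
    then have "qball X d x (min r s) \<subseteq> S \<inter> T"
      using r(2) s(2) by (meson Int_mono subset_trans)
    moreover have "min r s > 0" using r(1) s(1) by simp
    ultimately show "\<exists>r>0. qball X d x r \<subseteq> S \<inter> T" by metis
  qed
  have union: "?P (\<Union>K)" if K: "\<forall>S\<in>K. ?P S" for K
  proof (intro conjI ballI)
    show "\<Union>K \<subseteq> X" using K by (simp add: Union_least)
  next
    fix x assume "x \<in> \<Union>K"
    then obtain S where S: "S \<in> K" "x \<in> S" by (rule UnionE)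
    then obtain r where r: "r > 0" "qball X d x r \<subseteq> S"
      using K by meson
    from S(1) r(2) have "qball X d x r \<subseteq> \<Union>K"
      by (meson Union_upper subset_trans)
    with r(1) show "\<exists>r>0. qball X d x r \<subseteq> \<Union>K" by metis
  qed
  have "istopology ?P"
    unfolding istopology_def
  proof (rule conjI)
    show "\<forall>S T. ?P S \<longrightarrow> ?P T \<longrightarrow> ?P (S \<inter> T)"
      by (intro allI impI) (rule inter)
    show "\<forall>K. (\<forall>S\<in>K. ?P S) \<longrightarrow> ?P (\<Union>K)"
      by (intro allI impI) (rule union)
  qed
  from topology_inverse'[OF this] show ?thesis
    unfolding qtopology_def by (rule fun_cong)
qed

definition space_of_homogeneous_type ::
    "'a set \<Rightarrow> ('a \<Rightarrow> 'a \<Rightarrow> real) \<Rightarrow> 'a measure \<Rightarrow> bool" where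
  "space_of_homogeneous_type X d \<mu> \<longleftrightarrow>
     quasi_metric_on X d \<and>
     space \<mu> = X \<and>
     sets \<mu> = sigma_sets X {U. openin (qtopology X d) U} \<and>
     (\<forall>x\<in>X. \<forall>r>0. qball X d x r \<in> sets \<mu> \<and>
        0 < emeasure \<mu> (qball X d x r) \<and> emeasure \<mu> (qball X d x r) < \<infinity>) \<and>
     (\<exists>c>0::real. \<forall>x\<in>X. \<forall>r>0.
        emeasure \<mu> (qball X d x (2 * r)) \<le> ennreal c * emeasure \<mu> (qball X d x r))"

definition ball_avg :: "'a measure \<Rightarrow> 'a set \<Rightarrow> ('a \<Rightarrow> real) \<Rightarrow> ennreal" where
  "ball_avg \<mu> B g = (\<integral>\<^sup>+x\<in>B. ennreal (g x) \<partial>\<mu>) / emeasure \<mu> B"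

definition BMO_norm ::
    "'a set \<Rightarrow> ('a \<Rightarrow> 'a \<Rightarrow> real) \<Rightarrow> 'a measure \<Rightarrow> ('a \<Rightarrow> real) \<Rightarrow> ennreal" where
  "BMO_norm X d \<mu> f = (SUP B\<in>qballs X d. INF c. ball_avg \<mu> B (\<lambda>x. \<bar>f x - c\<bar>))"

text \<open>The infimum over \<open>\<lambda>\<close> is taken in \<open>[0,\<infinity>]\<close>, so that it is \<open>\<infinity>\<close> for the empty set.\<close>

definition BMO_phi_norm ::
    "(real \<Rightarrow> real) \<Rightarrow> 'a set \<Rightarrow> ('a \<Rightarrow> 'a \<Rightarrow> real) \<Rightarrow> 'a measure \<Rightarrow> ('a \<Rightarrow> real) \<Rightarrow> ennreal" where
  "BMO_phi_norm \<phi> X d \<mu> f =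
     (SUP B\<in>qballs X d. INF c.
        Inf {ennreal l | l. 0 < l \<and> ball_avg \<mu> B (\<lambda>x. \<phi> (\<bar>f x - c\<bar> / l)) \<le> 1})"

definition BMO :: "'a set \<Rightarrow> ('a \<Rightarrow> 'a \<Rightarrow> real) \<Rightarrow> 'a measure \<Rightarrow> ('a \<Rightarrow> real) set" where
  "BMO X d \<mu> = {f \<in> borel_measurable \<mu>. BMO_norm X d \<mu> f < \<infinity>}"

definition BMO_phi ::
    "(real \<Rightarrow> real) \<Rightarrow> 'a set \<Rightarrow> ('a \<Rightarrow> 'a \<Rightarrow> real) \<Rightarrow> 'a measure \<Rightarrow> ('a \<Rightarrow> real) set" where
  "BMO_phi \<phi> X d \<mu> = {f \<in> borel_measurable \<mu>. BMO_phi_norm \<phi> X d \<mu> f < \<infinity>}"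

end

theory Submission
  imports Defs
begin

text \<open>
  The lower bound is Jensen's inequality: with \<open>\<phi> t0 = 1\<close>, a supporting line of \<open>\<phi>\<close> at \<open>t0\<close>
  shows that the mean of \<open>\<phi> (\<bar>f - c\<bar> / l)\<close> is at most 1 once the mean of \<open>\<bar>f - c\<bar>\<close> is at most
  \<open>l * t0\<close>.

  For the upper bound, Chebyshev's inequality gives, for every ball, a number \<open>c\<close> with
  \<open>\<bar>f - c\<bar> \<le> L\<close> off a proportion \<open>s\<close> of the ball, where \<open>s\<close> is as small as we like.  A
  John--Stromberg stopping-time argument then yields exponential decay: starting from a ball with
  number \<open>c0\<close>, stop at the first dyadic radius about \<open>x\<close> whose number is more than \<open>4 * L\<close> away from
  \<open>c0\<close>.  On most of a stopped ball \<open>f\<close> is far from \<open>c0\<close>, so a disjoint family of stopped balls has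
  small total measure; their dilates cover almost all of the set where \<open>\<bar>f - c0\<bar>\<close> is large, and one
  iterates inside them.  That points which never stop form a null part of this set uses only
  outer regularity of the measure and Vitali's covering lemma.
\<close>

subsection \<open>Disjoint subfamilies\<close>

text \<open>Vitali selection with a natural number in place of the radius. Zorn's lemma runs over
  disjoint families that are \<open>good\<close>: an index whose set meets the family also meets a
  member of no larger rank. In a maximal such family nothing is missed, since a missed index of
  least rank could be added.\<close>

lemma maximal_disjoint_subfamily:
  fixes S :: "'i \<Rightarrow> 'b set" and rank :: "'i \<Rightarrow> nat"
  assumes nonempty: "\<And>i. i \<in> I \<Longrightarrow> S i \<noteq> {}"
  obtains J where "J \<subseteq> I" "pairwise (\<lambda>i j. disjnt (S i) (S j)) J"
    "\<forall>i\<in>I. \<exists>j\<in>J. rank j \<le> rank i \<and> \<not> disjnt (S i) (S j)"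
proof -
  define good where "good J \<longleftrightarrow> (\<forall>i\<in>I. \<forall>j\<in>J. \<not> disjnt (S i) (S j) \<longrightarrow>
    (\<exists>j\<in>J. rank j \<le> rank i \<and> \<not> disjnt (S i) (S j)))" for J
  define \<A> where "\<A> = {J. J \<subseteq> I \<and> pairwise (\<lambda>i j. disjnt (S i) (S j)) J \<and> good J}"
  have "\<exists>J\<in>\<A>. \<forall>J'\<in>\<A>. J \<subseteq> J' \<longrightarrow> J' = J"
  proof (rule subset_Zorn')
    fix C assume C: "subset.chain \<A> C"
    then have sub: "P \<subseteq> I" "pairwise (\<lambda>i j. disjnt (S i) (S j)) P" "good P" if "P \<in> C" for P
      using that by (auto simp: subset_chain_def \<A>_def)
    have "pairwise (\<lambda>i j. disjnt (S i) (S j)) (\<Union>C)"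
    proof (rule pairwiseI)
      fix i j assume ij: "i \<in> \<Union>C" "j \<in> \<Union>C" "i \<noteq> j"
      then obtain P P' where "P \<in> C" "i \<in> P" "P' \<in> C" "j \<in> P'" by blast
      moreover have "P \<subseteq> P' \<or> P' \<subseteq> P"
        using C \<open>P \<in> C\<close> \<open>P' \<in> C\<close> by (simp add: subset_chain_def)
      ultimately obtain P where P: "P \<in> C" "i \<in> P" "j \<in> P" by blast
      show "disjnt (S i) (S j)"
        by (rule pairwiseD[OF sub(2)[OF P(1)] P(2,3) ij(3)])
    qed
    moreover have "good (\<Union>C)"
      unfolding good_def
    proof (intro ballI impI)
      fix i j assume i: "i \<in> I" and "j \<in> \<Union>C" and ij: "\<not> disjnt (S i) (S j)"
      then obtain P where P: "P \<in> C" "j \<in> P" by blast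
      then obtain k where "k \<in> P" "rank k \<le> rank i \<and> \<not> disjnt (S i) (S k)"
        using sub(3)[OF P(1)] i ij unfolding good_def by blast
      then show "\<exists>j\<in>\<Union>C. rank j \<le> rank i \<and> \<not> disjnt (S i) (S j)" using P(1) by blast
    qed
    ultimately show "\<Union>C \<in> \<A>" using sub(1) unfolding \<A>_def by blast
  qed
  then obtain J where J: "J \<in> \<A>" and max: "\<And>J'. J' \<in> \<A> \<Longrightarrow> J \<subseteq> J' \<Longrightarrow> J' = J" by blast
  then have J': "J \<subseteq> I" "pairwise (\<lambda>i j. disjnt (S i) (S j)) J" "good J" by (auto simp: \<A>_def)
  have meets: "\<exists>j\<in>J. \<not> disjnt (S i) (S j)" if "i \<in> I" for i
  proof (rule ccontr)
    assume neg: "\<not> ?thesis"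
    define P where "P k \<longleftrightarrow> k \<in> I \<and> (\<forall>j\<in>J. disjnt (S k) (S j))" for k
    have "P i" using that neg by (simp add: P_def)
    then obtain k where k: "P k" "\<forall>k'. P k' \<longrightarrow> rank k \<le> rank k'"
      using ex_has_least_nat[of P i rank] by blast
    \<comment> \<open>An index missed by \<open>J\<close> has rank at least that of
      \<open>k\<close>, by minimality, so \<open>k\<close> serves it; every other index of
      \<open>I\<close> is already served by \<open>J\<close>.\<close>
    have "good (insert k J)"
      unfolding good_def
    proof (intro ballI impI)
      fix i j assume i: "i \<in> I" and j: "j \<in> insert k J" and ij: "\<not> disjnt (S i) (S j)"
      show "\<exists>j\<in>insert k J. rank j \<le> rank i \<and> \<not> disjnt (S i) (S j)"
      proof (cases "P i")
        case True
        then have "j = k" using j ij by (auto simp: P_def)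
        then show ?thesis using True k(2) ij by blast
      next
        case False
        then obtain j' where "j' \<in> J" "\<not> disjnt (S i) (S j')" using i by (auto simp: P_def)
        then show ?thesis using J'(3) i unfolding good_def by blast
      qed
    qed
    moreover have "pairwise (\<lambda>i j. disjnt (S i) (S j)) (insert k J)"
      using J'(2) k(1) disjnt_sym unfolding P_def pairwise_insert by metis
    ultimately have "insert k J \<in> \<A>"
      using J'(1) k(1) by (simp add: \<A>_def P_def)
    then have "k \<in> J" using max by blast
    then have "disjnt (S k) (S k)" using k(1) unfolding P_def by blast
    then show False using nonempty[of k] k(1) by (simp add: P_def)
  qed
  then have "\<forall>i\<in>I. \<exists>j\<in>J. rank j \<le> rank i \<and> \<not> disjnt (S i) (S j)"
    using J'(3) unfolding good_def by blast
  with J'(1,2) show thesis by (rule that)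
qed

text \<open>Shared by both covering arguments: \<open>Y j\<close> is a dilated ball or a bad subset
  of it, and \<open>D j\<close> a piece of the selected ball. Subadditivity for the
  \<open>Y j\<close> and additivity for the \<open>D j\<close> give the bound on finite subfamilies,
  uniformly, so it passes to the countable union.\<close>

lemma measure_UN_le_disjoint:
  assumes "countable J" "0 \<le> C" "V \<in> fmeasurable M"
    and Y: "\<And>j. j \<in> J \<Longrightarrow> Y j \<in> fmeasurable M"
    and D: "\<And>j. j \<in> J \<Longrightarrow> D j \<in> sets M" "\<And>j. j \<in> J \<Longrightarrow> D j \<subseteq> V"
      "pairwise (\<lambda>i j. disjnt (D i) (D j)) J"
    and le: "\<And>j. j \<in> J \<Longrightarrow> measure M (Y j) \<le> C * measure M (D j)"
  shows "(\<Union>j\<in>J. Y j) \<in> fmeasurable M \<and> measure M (\<Union>j\<in>J. Y j) \<le> C * measure M V"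
proof -
  have *: "measure M (\<Union>j\<in>J'. Y j) \<le> C * measure M V" if J': "J' \<subseteq> J" "finite J'" for J'
  proof -
    have fm: "D j \<in> fmeasurable M" if "j \<in> J" for j
      using D(1,2)[OF that] \<open>V \<in> _\<close> by (auto intro: fmeasurableI2)
    have "measure M (\<Union>j\<in>J'. Y j) \<le> (\<Sum>j\<in>J'. measure M (Y j))"
      using J' Y by (intro measure_UNION_le) auto
    also have "\<dots> \<le> (\<Sum>j\<in>J'. C * measure M (D j))"
      using J' le by (intro sum_mono) auto
    also have "\<dots> = C * measure M (\<Union>j\<in>J'. D j)"
      using J' fm D(3) by (subst measure_UNION') (auto simp: sum_distrib_left intro: pairwise_subset)
    also have "\<dots> \<le> C * measure M V"
    proof (intro mult_left_mono measure_mono_fmeasurable)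
      show "(\<Union>j\<in>J'. D j) \<subseteq> V" using J' D(2) by blast
      show "(\<Union>j\<in>J'. D j) \<in> sets M" using J' D(1) by (intro sets.finite_UN) auto
    qed (use assms in auto)
    finally show ?thesis .
  qed
  show ?thesis
    using fmeasurable_UN_bound[OF assms(1) Y *] measure_UN_bound[OF assms(1) Y *] by auto
qed

text \<open>Zorn's lemma yields no enumeration of the selected family. Finite sums of the measures
  stay below that of \<open>V\<close>, and a summable family of positive reals is countable.\<close>

lemma countable_disjoint_positive_measure:
  assumes "V \<in> fmeasurable M"
    and D: "\<And>j. j \<in> J \<Longrightarrow> D j \<in> sets M" "\<And>j. j \<in> J \<Longrightarrow> D j \<subseteq> V"
      "pairwise (\<lambda>i j. disjnt (D i) (D j)) J"
    and pos: "\<And>j. j \<in> J \<Longrightarrow> 0 < measure M (D j)"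
  shows "countable J"
proof -
  have "(\<lambda>j. measure M (D j)) summable_on J"
  proof (rule nonneg_bdd_above_summable_on)
    show "bdd_above (sum (\<lambda>j. measure M (D j)) ` {F. F \<subseteq> J \<and> finite F})"
    proof (rule bdd_aboveI2)
      fix F assume F: "F \<in> {F. F \<subseteq> J \<and> finite F}"
      have fm: "D j \<in> fmeasurable M" if "j \<in> J" for j
        using D(1,2)[OF that] \<open>V \<in> _\<close> by (auto intro: fmeasurableI2)
      have "(\<Sum>j\<in>F. measure M (D j)) = measure M (\<Union>j\<in>F. D j)"
        using F fm D(3) by (subst measure_UNION') (auto intro: pairwise_subset)
      also have "\<dots> \<le> measure M V"
        using F D assms(1) by (intro measure_mono_fmeasurable sets.finite_UN) auto
      finally show "(\<Sum>j\<in>F. measure M (D j)) \<le> measure M V" .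
    qed
  qed simp
  from summable_countable_real[OF this] show ?thesis
    using pos by (metis (mono_tags, lifting) Collect_cong Collect_mem_eq order_less_irrefl)
qed

subsection \<open>Covering and density in spaces of homogeneous type\<close>

text \<open>The factor \<open>3 * \<kappa>\<^sup>2\<close> is the dilation that makes a ball swallow every ball of
  at most the same radius that meets it; two such dilations suffice below, so the doubling condition
  is recorded for their composition.\<close>

locale homogeneous_space =
  fixes X :: "'a set" and d :: "'a \<Rightarrow> 'a \<Rightarrow> real" and \<mu> :: "'a measure" and \<kappa> Q :: real
  assumes nonneg: "x \<in> X \<Longrightarrow> y \<in> X \<Longrightarrow> 0 \<le> d x y"
    and dist_self: "x \<in> X \<Longrightarrow> d x x = 0"
    and sym: "x \<in> X \<Longrightarrow> y \<in> X \<Longrightarrow> d x y = d y x"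
    and kappa: "1 \<le> \<kappa>"
    and tri: "x \<in> X \<Longrightarrow> y \<in> X \<Longrightarrow> z \<in> X \<Longrightarrow> d x y \<le> \<kappa> * (d x z + d z y)"
    and space_eq: "space \<mu> = X"
    and sets_eq: "sets \<mu> = sigma_sets X {U. openin (qtopology X d) U}"
    and ball_fm: "x \<in> X \<Longrightarrow> 0 < r \<Longrightarrow> qball X d x r \<in> fmeasurable \<mu>"
    and ball_pos: "x \<in> X \<Longrightarrow> 0 < r \<Longrightarrow> 0 < measure \<mu> (qball X d x r)"
    and Q: "1 \<le> Q"
    and doubling: "x \<in> X \<Longrightarrow> 0 < r \<Longrightarrow>
      measure \<mu> (qball X d x ((3 * \<kappa>\<^sup>2)\<^sup>2 * r)) \<le> Q * measure \<mu> (qball X d x r)"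
begin

abbreviation B :: "'a \<Rightarrow> real \<Rightarrow> 'a set" where "B \<equiv> qball X d"

abbreviation qopen :: "'a set \<Rightarrow> bool" where "qopen \<equiv> openin (qtopology X d)"

section \<open>Ball inclusions and doubling\<close>

definition K :: real where "K = 3 * \<kappa>\<^sup>2"

lemma K_ge: "3 \<le> K"
  using kappa by (simp add: K_def one_le_power)

lemma ball_mono: "r \<le> r' \<Longrightarrow> B x r \<subseteq> B x r'"
  by (auto simp: qball_def)

lemma centre_in_ball: "x \<in> X \<Longrightarrow> 0 < r \<Longrightarrow> x \<in> B x r"
  by (auto simp: qball_def dist_self)

lemma ball_subset: "B x r \<subseteq> X"
  by (auto simp: qball_def)

text \<open>Let \<open>w\<close> be a common point and \<open>z\<close> in the first ball. Going
  through the centre \<open>x\<close> gives \<open>d w z \<le> \<kappa> * (2 * r')\<close>, and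
  going through \<open>w\<close> gives \<open>d y z < \<kappa> * (r' + \<kappa> * (2 * r'))\<close>,
  which is at most \<open>K * r'\<close> because \<open>1 \<le> \<kappa>\<close>.\<close>

lemma engulf:
  assumes "x \<in> X" "y \<in> X" "r \<le> r'" "\<not> disjnt (B x r) (B y r')"
  shows "B x r \<subseteq> B y (K * r')"
proof
  fix z assume z: "z \<in> B x r"
  obtain w where w: "w \<in> B x r" "w \<in> B y r'"
    using assms by (auto simp: disjnt_def)
  have X: "z \<in> X" "w \<in> X" and d: "d x z < r" "d x w < r" "d y w < r'"
    using z w by (auto simp: qball_def)
  have "r' > 0" using d nonneg[of y w] assms X by auto
  have "d w z \<le> \<kappa> * (d w x + d x z)" using tri[of w z x] X assms by auto
  also have "\<dots> \<le> \<kappa> * (2 * r')"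
    using d assms X kappa sym[of w x] by (intro mult_left_mono) auto
  finally have "d w z \<le> \<kappa> * (2 * r')" .
  then have "d y w + d w z < r' + \<kappa> * (2 * r')" using d by linarith
  also have "\<dots> \<le> \<kappa> * (3 * r')" using kappa \<open>r' > 0\<close> by (simp add: algebra_simps)
  finally have "\<kappa> * (d y w + d w z) < \<kappa> * (\<kappa> * (3 * r'))"
    using kappa by (intro mult_strict_left_mono) auto
  moreover have "d y z \<le> \<kappa> * (d y w + d w z)" using tri[of y z w] X assms by auto
  ultimately show "z \<in> B y (K * r')"
    using X by (simp add: qball_def K_def power2_eq_square mult_ac)
qed

lemma ball_K:
  assumes "x \<in> X" "x' \<in> B x R"
  shows "B x' R \<subseteq> B x (K * R)"
proof -
  have "0 < R" "x' \<in> X" using assms nonneg[of x x'] by (auto simp: qball_def)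
  then have "x' \<in> B x' R" by (simp add: centre_in_ball)
  then show ?thesis
    using assms \<open>x' \<in> X\<close> by (intro engulf) (auto simp: disjnt_def)
qed

lemma doubling_K2: "x \<in> X \<Longrightarrow> 0 < r \<Longrightarrow> measure \<mu> (B x (K * (K * r))) \<le> Q * measure \<mu> (B x r)"
  using doubling[of x r] by (simp add: K_def power2_eq_square mult_ac)

lemma doubling_le:
  assumes "x \<in> X" "0 < r" "r' \<le> K * (K * r)" "0 < r'"
  shows "measure \<mu> (B x r') \<le> Q * measure \<mu> (B x r)"
proof -
  have "measure \<mu> (B x r') \<le> measure \<mu> (B x (K * (K * r)))"
    using assms K_ge by (intro measure_mono_fmeasurable ball_mono fmeasurableD ball_fm) auto
  then show ?thesis using doubling_K2 assms by force
qed

lemma doubling_K: "x \<in> X \<Longrightarrow> 0 < r \<Longrightarrow> measure \<mu> (B x (K * r)) \<le> Q * measure \<mu> (B x r)"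
  using K_ge by (intro doubling_le) auto

lemma doubling_2: "x \<in> X \<Longrightarrow> 0 < r \<Longrightarrow> measure \<mu> (B x (2 * r)) \<le> Q * measure \<mu> (B x r)"
proof (intro doubling_le)
  assume "0 < r"
  have "2 * r \<le> K * r" using K_ge \<open>0 < r\<close> by simp
  also have "\<dots> \<le> K * (K * r)" using K_ge \<open>0 < r\<close> by simp
  finally show "2 * r \<le> K * (K * r)" .
qed auto

section \<open>Regularity of the measure\<close>

lemma qopen_sets: "qopen U \<Longrightarrow> U \<in> sets \<mu>"
  unfolding sets_eq by auto

text \<open>Balls need not be open, so open sets are produced as cores of arbitrary sets. If
  \<open>B x r\<close> lies in \<open>A\<close> and \<open>y\<close> is in
  \<open>B x (r / K)\<close>, then \<open>B y (r / K)\<close> lies in \<open>B x r\<close>, so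
  \<open>y\<close> is in the core as well.\<close>

lemma qopen_core:
  assumes "A \<subseteq> X"
  shows "qopen {x \<in> X. \<exists>r>0. B x r \<subseteq> A}"
  unfolding openin_qtopology
proof safe
  fix x r assume x: "x \<in> X" "0 < r" "B x r \<subseteq> A"
  have "B x (r / K) \<subseteq> {x \<in> X. \<exists>r>0. B x r \<subseteq> A}"
  proof
    fix y assume y: "y \<in> B x (r / K)"
    then have "B y (r / K) \<subseteq> B x (K * (r / K))" using x by (intro ball_K) auto
    then have "B y (r / K) \<subseteq> A" using x K_ge by auto
    then show "y \<in> {x \<in> X. \<exists>r>0. B x r \<subseteq> A}"
      using y x K_ge by (auto simp: qball_def intro!: exI[of _ "r / K"])
  qed
  then show "\<exists>r>0. B x r \<subseteq> {x \<in> X. \<exists>r>0. B x r \<subseteq> A}"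
    using x K_ge by (intro exI[of _ "r / K"]) auto
qed

text \<open>The \<open>G n\<close> are cores of the neighbourhoods of radius 1/(n+1) of the closed
  set \<open>X - U\<close>. A point of \<open>U\<close> is the centre of a ball of some radius
  \<open>r\<close> inside \<open>U\<close>, so by symmetry of \<open>d\<close> it lies in no such
  neighbourhood with 1/(n+1) < \<open>r\<close>.\<close>

lemma closed_decreasing_qopen:
  assumes "qopen U"
  obtains G where "\<forall>n::nat. qopen (G n)" "decseq G" "\<forall>n. X - U \<subseteq> G n" "(\<Inter>n. G n) = X - U"
proof -
  define H where "H n = (\<Union>y\<in>X - U. B y (1 / Suc n))" for n
  define G where "G n = {x \<in> X. \<exists>r>0. B x r \<subseteq> H n}" for n
  have "H n \<subseteq> X" for n by (auto simp: H_def qball_def)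
  then have qopen: "qopen (G n)" for n unfolding G_def by (rule qopen_core)
  have "B y (1 / Suc n) \<subseteq> B y (1 / Suc m)" if "m \<le> n" for y m n
    using that by (intro ball_mono) (auto simp: field_simps)
  then have "H n \<subseteq> H m" if "m \<le> n" for m n
    unfolding H_def using that by blast
  then have dec: "decseq G" unfolding G_def decseq_def by blast
  have sub: "X - U \<subseteq> G n" for n
  proof
    fix y assume y: "y \<in> X - U"
    then have "B y (1 / Suc n) \<subseteq> H n" by (auto simp: H_def)
    then show "y \<in> G n" using y unfolding G_def by (auto intro!: exI[of _ "1 / Suc n"])
  qed
  have "x \<in> X - U" if x: "x \<in> (\<Inter>n. G n)" for x
  proof (rule ccontr)
    assume "x \<notin> X - U"
    moreover have "x \<in> X" using x by (auto simp: G_def)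
    ultimately obtain r where r: "r > 0" "B x r \<subseteq> U" using assms by (auto simp: openin_qtopology)
    obtain n where n: "1 / Suc n < r" using nat_approx_posE[OF r(1)] by auto
    obtain s where s: "s > 0" "B x s \<subseteq> H n" using x by (auto simp: G_def)
    then have "x \<in> H n" using centre_in_ball \<open>x \<in> X\<close> by blast
    then obtain y where y: "y \<in> X - U" "d y x < 1 / Suc n" by (auto simp: H_def qball_def)
    then have "y \<in> B x r" using sym \<open>x \<in> X\<close> n by (auto simp: qball_def)
    then show False using r y by auto
  qed
  then have "(\<Inter>n. G n) = X - U" using sub by auto
  with qopen dec sub show thesis by (intro that) auto
qed

lemma measure_Int_decseq_less:
  assumes W: "W \<in> fmeasurable \<mu>" and G: "\<And>n. G n \<in> sets \<mu>" "decseq G" "(\<Inter>n. G n) = {}" and "0 < e"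
  shows "\<exists>n::nat. measure \<mu> (W \<inter> G n) < e"
proof -
  have "(\<lambda>n. measure \<mu> (W \<inter> G n)) \<longlonglongrightarrow> measure \<mu> (\<Inter>n. W \<inter> G n)"
  proof (rule Lim_measure_decseq)
    show "emeasure \<mu> (W \<inter> G i) \<noteq> \<infinity>" for i
      using fmeasurableD2[OF fmeasurable_Int_fmeasurable[OF W G(1)[of i]]] by simp
  qed (use W G in \<open>auto simp: decseq_def\<close>)
  moreover have "(\<Inter>n. W \<inter> G n) = {}" using G(3) by auto
  ultimately have "(\<lambda>n. measure \<mu> (W \<inter> G n)) \<longlonglongrightarrow> 0" by simp
  then have "eventually (\<lambda>n. measure \<mu> (W \<inter> G n) < e) sequentially"
    using order_tendstoD(2)[OF _ \<open>0 < e\<close>] by blast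
  then show ?thesis by (auto simp: eventually_sequentially)
qed

text \<open>Induction on the generation of the Borel sets. Approximating from both sides turns the
  complement case into a swap of \<open>U\<close> and \<open>F\<close>; intersecting with
  \<open>W\<close> supplies the finite measure that continuity from above requires.\<close>

lemma regularity:
  assumes W: "W \<in> fmeasurable \<mu>" and E: "E \<in> sets \<mu>" and e: "0 < e"
  shows "\<exists>U F. qopen U \<and> qopen (X - F) \<and> F \<subseteq> E \<and> E \<subseteq> U \<and> measure \<mu> (W \<inter> (U - F)) < e"
proof -
  have "E \<in> sigma_sets X {U. qopen U}" using E by (simp add: sets_eq)
  then show ?thesis using e
  proof (induction arbitrary: e)
    case (Basic U)
    then have U: "qopen U" by simp
    then obtain G where G': "\<forall>n::nat. qopen (G n)" "decseq G" "\<forall>n. X - U \<subseteq> G n" "(\<Inter>n. G n) = X - U"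
      by (rule closed_decreasing_qopen)
    then have G: "\<And>n::nat. qopen (G n)" "decseq G" "\<And>n. X - U \<subseteq> G n" "(\<Inter>n. G n) = X - U" by auto
    have "\<exists>n. measure \<mu> (W \<inter> (U \<inter> G n)) < e"
      using U G Basic by (intro measure_Int_decseq_less W) (auto simp: decseq_def intro!: qopen_sets)
    then obtain n where n: "measure \<mu> (W \<inter> (U \<inter> G n)) < e" by blast
    have "G n \<subseteq> X" "U \<subseteq> X" using G(1)[of n] U by (simp_all add: openin_qtopology)
    then have "X - (X - G n) = G n" "X - G n \<subseteq> U" "W \<inter> (U - (X - G n)) = W \<inter> (U \<inter> G n)"
      using G(3)[of n] by auto
    then show ?case using n U G(1)[of n] by (intro exI[of _ U] exI[of _ "X - G n"]) simp
  next
    case Empty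
    then show ?case using openin_empty openin_qtopology
      by (intro exI[of _ "{}"] exI[of _ "{}"]) (auto simp: openin_qtopology intro!: exI[of _ 1] simp: qball_def)
  next
    case (Compl E)
    then obtain U F where UF: "qopen U" "qopen (X - F)" "F \<subseteq> E" "E \<subseteq> U" "measure \<mu> (W \<inter> (U - F)) < e" by blast
    have "U \<subseteq> X" using UF(1) by (simp add: openin_qtopology)
    then have "X - (X - U) = U" "W \<inter> ((X - F) - (X - U)) = W \<inter> (U - F)" by auto
    then show ?case using UF by (intro exI[of _ "X - F"] exI[of _ "X - U"]) auto
  next
    case (Union E)
    \<comment> \<open>Half of \<open>e\<close> is spread geometrically over the sets
      \<open>E n\<close>. The other half pays for replacing the union of the \<open>F n\<close>,
      which need not be closed, by a finite union.\<close>
    have "\<exists>U F. qopen U \<and> qopen (X - F) \<and> F \<subseteq> E n \<and> E n \<subseteq> U \<and> measure \<mu> (W \<inter> (U - F)) < (e / 2) * (1 / 2) ^ Suc n" for n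
      using Union.prems by (intro Union.IH) simp
    then obtain U F where UF: "\<And>n. qopen (U n)" "\<And>n. qopen (X - F n)" "\<And>n. F n \<subseteq> E n" "\<And>n. E n \<subseteq> U n"
      "\<And>n. measure \<mu> (W \<inter> (U n - F n)) < (e / 2) * (1 / 2) ^ Suc n" by metis
    have UX: "U n \<subseteq> X" for n using UF(1)[of n] by (simp add: openin_qtopology)
    have "X - (X - F n) = F n" for n using UF(3)[of n] UF(4)[of n] UX[of n] by auto
    then have Fs: "F n \<in> sets \<mu>" for n
      using sets.compl_sets[OF qopen_sets[OF UF(2)[of n]]] by (simp add: space_eq)
    have Us: "U n \<in> sets \<mu>" for n using UF(1) qopen_sets by blast
    define G where "G n = (\<Union>i. F i) - (\<Union>i<n. F i)" for n
    have "\<exists>n. measure \<mu> (W \<inter> G n) < e / 2"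
    proof (rule measure_Int_decseq_less[OF W])
      show "G n \<in> sets \<mu>" for n using Fs by (auto simp: G_def)
      show "decseq G" by (auto simp: G_def decseq_def)
      show "(\<Inter>n. G n) = {}" by (auto simp: G_def)
    qed (use Union.prems in simp)
    then obtain N where N: "measure \<mu> (W \<inter> G N) < e / 2" by blast
    define F' where "F' = (\<Union>i<N. F i)"
    have opF: "qopen (X - F')"
    proof (cases "N = 0")
      case True
      then show ?thesis by (auto simp: F'_def openin_qtopology qball_def intro!: exI[of _ 1])
    next
      case False
      then have "X - F' = (\<Inter>i\<in>{..<N}. X - F i)" by (auto simp: F'_def)
      moreover have "qopen \<dots>" using UF(2) False by (intro openin_INT2) auto
      ultimately show ?thesis by simp
    qed
    have m1: "measure \<mu> (W \<inter> (\<Union>n. U n - F n)) \<le> e / 2"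
    proof -
      have "measure \<mu> (\<Union>n. W \<inter> (U n - F n)) \<le> e / 2"
      proof (rule measure_countable_Union_le)
        fix n
        show "W \<inter> (U n - F n) \<in> fmeasurable \<mu>" for n
          using W Us Fs by (intro fmeasurable_Int_fmeasurable) auto
        have "measure \<mu> (\<Union>i\<le>n. W \<inter> (U i - F i)) \<le> (\<Sum>i\<le>n. measure \<mu> (W \<inter> (U i - F i)))"
          using W Us Fs by (intro measure_UNION_le) auto
        also have "\<dots> \<le> (\<Sum>i\<le>n. (e / 2) * (1 / 2) ^ Suc i)"
          using UF(5) by (intro sum_mono) (simp add: less_imp_le)
        also have "\<dots> = (e / 2) * (\<Sum>i\<le>n. (1 / 2) ^ Suc i)" by (simp add: sum_distrib_left)
        also have "\<dots> = (e / 2) * (1 - (1 / 2) ^ Suc n)"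
          by (induction n) (auto simp: algebra_simps)
        also have "\<dots> \<le> e / 2" using Union.prems by (simp add: algebra_simps)
        finally show "measure \<mu> (\<Union>i\<le>n. W \<inter> (U i - F i)) \<le> e / 2" .
      qed
      moreover have "(\<Union>n. W \<inter> (U n - F n)) = W \<inter> (\<Union>n. U n - F n)" by blast
      ultimately show ?thesis by (simp only:)
    qed
    have "measure \<mu> (W \<inter> ((\<Union>n. U n) - F')) \<le> measure \<mu> ((W \<inter> (\<Union>n. U n - F n)) \<union> (W \<inter> G N))"
    proof (rule measure_mono_fmeasurable)
      show "W \<inter> (\<Union> (range U) - F') \<subseteq> W \<inter> (\<Union>n. U n - F n) \<union> W \<inter> G N"
        by (auto simp: F'_def G_def)
      show "W \<inter> (\<Union>n. U n - F n) \<union> W \<inter> G N \<in> fmeasurable \<mu>"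
        using W Us Fs unfolding G_def by (intro fmeasurable.Un fmeasurable_Int_fmeasurable) auto
      show "W \<inter> (\<Union> (range U) - F') \<in> sets \<mu>" using W Us Fs unfolding F'_def by auto
    qed
    also have "\<dots> \<le> measure \<mu> (W \<inter> (\<Union>n. U n - F n)) + measure \<mu> (W \<inter> G N)"
      using W Us Fs unfolding G_def by (intro measure_Un_le) auto
    also have "\<dots> < e" using m1 N by linarith
    finally have "measure \<mu> (W \<inter> ((\<Union>n. U n) - F')) < e" .
    moreover have "qopen (\<Union>n. U n)" using UF(1) by auto
    moreover have "F' \<subseteq> (\<Union>n. E n)" "(\<Union>n. E n) \<subseteq> (\<Union>n. U n)"
      using UF(3,4) by (auto simp: F'_def) blast+
    ultimately show ?case using opF by (intro exI[of _ "\<Union>n. U n"] exI[of _ F']) auto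
  qed
qed

text \<open>The exponent \<open>n\<close> is the rank, so a smaller rank means a larger radius: a
  selected ball of rank at most \<open>n\<close> that meets \<open>B x (R / 2 ^ n)\<close> engulfs
  it after dilation by \<open>K\<close>. The bounding set \<open>V\<close> makes the selection
  countable.\<close>

lemma vitali_covering:
  assumes I: "\<And>x n. (x, n) \<in> I \<Longrightarrow> x \<in> X" and "0 < R" and V: "V \<in> fmeasurable \<mu>"
    and IV: "\<And>x n. (x, n) \<in> I \<Longrightarrow> B x (R / 2 ^ n) \<subseteq> V"
  obtains J where "J \<subseteq> I" "countable J"
    "pairwise (\<lambda>(x, n) (y, k). disjnt (B x (R / 2 ^ n)) (B y (R / 2 ^ k))) J"
    "\<And>x n. (x, n) \<in> I \<Longrightarrow> \<exists>(y, k)\<in>J. x \<in> B y (K * (R / 2 ^ k))"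
proof -
  define S where "S = (\<lambda>(x, n::nat). B x (R / 2 ^ n))"
  have "S i \<noteq> {}" if "i \<in> I" for i
    using that I centre_in_ball[of "fst i" "R / 2 ^ snd i"] \<open>0 < R\<close> by (cases i) (auto simp: S_def)
  then obtain J where J: "J \<subseteq> I" "pairwise (\<lambda>i j. disjnt (S i) (S j)) J"
    "\<forall>i\<in>I. \<exists>j\<in>J. snd j \<le> snd i \<and> \<not> disjnt (S i) (S j)"
    by (rule maximal_disjoint_subfamily[where rank = snd]) blast
  have "countable J"
  proof (rule countable_disjoint_positive_measure[OF V, of _ S])
    fix j assume "j \<in> J"
    then have "j \<in> I" using J by auto
    then show "S j \<in> sets \<mu>" "S j \<subseteq> V" "0 < measure \<mu> (S j)"
      using I IV \<open>0 < R\<close> by (cases j; auto simp: S_def intro!: ball_pos fmeasurableD ball_fm; fail)+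
  qed (rule J)
  moreover have "\<exists>(y, k)\<in>J. x \<in> B y (K * (R / 2 ^ k))" if xn: "(x, n) \<in> I" for x n
  proof -
    obtain y k where yk: "(y, k) \<in> J" "k \<le> n" "\<not> disjnt (B x (R / 2 ^ n)) (B y (R / 2 ^ k))"
      using bspec[OF J(3) xn] by (auto simp: S_def)
    have "R / 2 ^ n \<le> R / 2 ^ k" using \<open>0 < R\<close> yk by (intro divide_left_mono power_increasing) auto
    then have "B x (R / 2 ^ n) \<subseteq> B y (K * (R / 2 ^ k))"
      using yk I xn J(1) by (intro engulf) blast+
    then show ?thesis using yk(1) centre_in_ball[of x "R / 2 ^ n"] I[OF xn] \<open>0 < R\<close> by auto
  qed
  ultimately show thesis
    using J by (intro that[of J]) (auto simp: S_def case_prod_unfold)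
qed

text \<open>A substitute for the Lebesgue density theorem: cover \<open>E\<close> by Vitali balls inside an open set
  \<open>U\<close> of nearly the same measure; each of them has a fixed proportion of its mass in \<open>U - E\<close>.\<close>

lemma null_if_low_density:
  assumes E: "E \<in> fmeasurable \<mu>" and "x0 \<in> X" "0 < R" and ER: "E \<subseteq> B x0 R" and th: "\<theta> < 1"
    and low: "\<And>x n. x \<in> E \<Longrightarrow>
      measure \<mu> (E \<inter> B x (R / 2 ^ n)) \<le> \<theta> * measure \<mu> (B x (R / 2 ^ n))"
  shows "measure \<mu> E = 0"
proof -
  \<comment> \<open>Removing \<open>E\<close> from a selected ball leaves at least the proportion
    \<open>1 - \<theta>\<close> of it, and dilating the ball by \<open>K\<close> costs the factor
    \<open>Q\<close>.\<close>
  define C where "C = Q / (1 - \<theta>)"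
  have "0 < C" using Q th by (simp add: C_def)
  define W where "W = B x0 (K * R)"
  have W: "W \<in> fmeasurable \<mu>" using ball_fm K_ge \<open>0 < R\<close> \<open>x0 \<in> X\<close> by (simp add: W_def)
  have "measure \<mu> E \<le> C * e" if "0 < e" for e
  proof -
    obtain U F where UF: "qopen U" "qopen (X - F)" "F \<subseteq> E" "E \<subseteq> U" "measure \<mu> (W \<inter> (U - F)) < e"
      using regularity[OF W fmeasurableD[OF E] \<open>0 < e\<close>] by blast
    define V where "V = W \<inter> U"
    have V: "V \<in> fmeasurable \<mu>" using W qopen_sets[OF UF(1)] by (auto simp: V_def intro: fmeasurable_Int_fmeasurable)
    define I where "I = {(x, n). x \<in> E \<and> B x (R / 2 ^ n) \<subseteq> V}"
    have EX: "E \<subseteq> X" using ER ball_subset by blast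
    obtain J where J: "J \<subseteq> I" "countable J"
      "pairwise (\<lambda>(x, n) (y, k). disjnt (B x (R / 2 ^ n)) (B y (R / 2 ^ k))) J"
      "\<And>x n. (x, n) \<in> I \<Longrightarrow> \<exists>(y, k)\<in>J. x \<in> B y (K * (R / 2 ^ k))"
      using vitali_covering[of I R V] EX \<open>0 < R\<close> V unfolding I_def by blast
    define Y where "Y = (\<lambda>(x, n::nat). B x (K * (R / 2 ^ n)))"
    define D where "D = (\<lambda>(x, n::nat). B x (R / 2 ^ n) - E)"
    have "\<exists>n. (x, n) \<in> I" if x: "x \<in> E" for x
    proof -
      obtain r where r: "r > 0" "B x r \<subseteq> U" using UF(1,4) x unfolding openin_qtopology by blast
      obtain n where n: "(1 / 2) ^ n < r / R"
        using real_arch_pow_inv[of "r / R" "1 / 2"] r \<open>0 < R\<close> by auto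
      then have "R / 2 ^ n < r" using \<open>0 < R\<close> by (simp add: field_simps)
      then have "B x (R / 2 ^ n) \<subseteq> U" using r ball_mono[of "R / 2 ^ n" r] by auto
      moreover have "B x (R / 2 ^ n) \<subseteq> B x R" using \<open>0 < R\<close> by (intro ball_mono) (simp add: field_simps)
      moreover have "B x R \<subseteq> W" unfolding W_def using ball_K \<open>x0 \<in> X\<close> x ER by blast
      ultimately show ?thesis using x by (auto simp: I_def V_def)
    qed
    then have cover: "E \<subseteq> (\<Union>j\<in>J. Y j)" using J(4) unfolding Y_def by fastforce
    have "(\<Union>j\<in>J. Y j) \<in> fmeasurable \<mu> \<and> measure \<mu> (\<Union>j\<in>J. Y j) \<le> C * measure \<mu> (V - E)"
    proof (rule measure_UN_le_disjoint[OF J(2), of C "V - E" \<mu> Y D])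
      show "V - E \<in> fmeasurable \<mu>" using V E by (intro fmeasurable.Diff)
      show "pairwise (\<lambda>i j. disjnt (D i) (D j)) J"
        using J(3) by (rule pairwise_mono) (auto simp: D_def disjnt_def)
      fix j assume "j \<in> J"
      then have "j \<in> I" using J(1) by blast
      then obtain x n where j: "j = (x, n)" and xn: "x \<in> E" "B x (R / 2 ^ n) \<subseteq> V" "x \<in> X"
        using EX by (cases j) (auto simp: I_def)
      define r where "r = R / 2 ^ n"
      have r: "r > 0" using \<open>0 < R\<close> by (simp add: r_def)
      have "0 < K * r" using K_ge r by simp
      then show "Y j \<in> fmeasurable \<mu>" using ball_fm[of x "K * r"] xn by (simp add: Y_def j r_def)
      show "D j \<in> sets \<mu>" using ball_fm[of x r] r xn E by (auto simp: D_def j r_def)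
      show "D j \<subseteq> V - E" using xn by (auto simp: D_def j)
      have "measure \<mu> (B x r) = measure \<mu> (E \<inter> B x r) + measure \<mu> (B x r - E)"
        using measure_Un2[of "E \<inter> B x r" \<mu> "B x r"] ball_fm[of x r] r xn E
        by (simp add: fmeasurable.Int Diff_Int Un_absorb1)
      then have "(1 - \<theta>) * measure \<mu> (B x r) \<le> measure \<mu> (B x r - E)"
        using low[OF xn(1), of n] by (simp add: r_def algebra_simps)
      then have "measure \<mu> (B x r) \<le> measure \<mu> (B x r - E) / (1 - \<theta>)"
        using th by (simp add: field_simps)
      then have "Q * measure \<mu> (B x r) \<le> Q * (measure \<mu> (B x r - E) / (1 - \<theta>))"
        using Q by (intro mult_left_mono) auto
      moreover have "measure \<mu> (B x (K * r)) \<le> Q * measure \<mu> (B x r)" using xn r by (intro doubling_K)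
      ultimately show "measure \<mu> (Y j) \<le> C * measure \<mu> (D j)"
        by (simp add: Y_def D_def j r_def C_def)
    qed (use \<open>0 < C\<close> in auto)
    then have le: "(\<Union>j\<in>J. Y j) \<in> fmeasurable \<mu>" "measure \<mu> (\<Union>j\<in>J. Y j) \<le> C * measure \<mu> (V - E)"
      by auto
    have "measure \<mu> E \<le> measure \<mu> (\<Union>j\<in>J. Y j)"
      using cover le(1) E by (intro measure_mono_fmeasurable) auto
    also have "\<dots> \<le> C * measure \<mu> (V - E)" by (rule le)
    also have "\<dots> \<le> C * measure \<mu> (W \<inter> (U - F))"
    proof (intro mult_left_mono measure_mono_fmeasurable)
      show "V - E \<subseteq> W \<inter> (U - F)" using UF(3) by (auto simp: V_def)
      have "X - (X - F) = F" using UF(3) EX by auto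
      then have "F \<in> sets \<mu>" using sets.compl_sets[OF qopen_sets[OF UF(2)]] by (simp add: space_eq)
      then show "W \<inter> (U - F) \<in> fmeasurable \<mu>" using W qopen_sets[OF UF(1)]
        by (intro fmeasurable_Int_fmeasurable) auto
    qed (use V E \<open>0 < C\<close> in auto)
    also have "\<dots> \<le> C * e" using UF(5) \<open>0 < C\<close> by simp
    finally show ?thesis .
  qed
  then have "measure \<mu> E \<le> 0 + e" if "0 < e" for e
    using that \<open>0 < C\<close> spec[of "\<lambda>e. 0 < e \<longrightarrow> measure \<mu> E \<le> C * e" "e / C"] by simp
  then have "measure \<mu> E \<le> 0" by (rule field_le_epsilon)
  then show ?thesis by (simp add: measure_le_0_iff)
qed

end

subsection \<open>Functions of small oscillation\<close>

text \<open>The number \<open>c x r\<close> plays the role of a median of \<open>f\<close> on the ball of radius \<open>r\<close> about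
  \<open>x\<close>: it approximates \<open>f\<close> up to \<open>L\<close> off a small proportion of the ball.\<close>

locale small_oscillation = homogeneous_space +
  fixes f :: "'a \<Rightarrow> real" and s L :: real and c :: "'a \<Rightarrow> real \<Rightarrow> real"
  assumes f: "f \<in> borel_measurable \<mu>"
    and L: "0 < L" and s: "0 \<le> s" "4 * Q\<^sup>2 * s \<le> 1"
    and osc: "x \<in> X \<Longrightarrow> 0 < r \<Longrightarrow>
      measure \<mu> {y \<in> qball X d x r. L < \<bar>f y - c x r\<bar>} \<le> s * measure \<mu> (qball X d x r)"
begin

lemma level_fm:
  assumes "x \<in> X" "0 < r"
  shows "{y \<in> B x r. t < \<bar>f y - a\<bar>} \<in> fmeasurable \<mu>"
proof -
  have "{y \<in> space \<mu>. t < \<bar>f y - a\<bar>} \<in> sets \<mu>" using f by measurable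
  moreover have "{y \<in> B x r. t < \<bar>f y - a\<bar>} = B x r \<inter> {y \<in> space \<mu>. t < \<bar>f y - a\<bar>}"
    using ball_subset by (auto simp: space_eq)
  ultimately show ?thesis using fmeasurable_Int_fmeasurable[OF ball_fm[OF assms]] by simp
qed

lemma Qs: "Q\<^sup>2 * s \<le> 1 / 4" "Q * s \<le> 1 / 4" "s \<le> 1 / 4"
proof -
  show *: "Q\<^sup>2 * s \<le> 1 / 4" using s by simp
  have "1 * (Q * s) \<le> Q * (Q * s)" using Q s by (intro mult_right_mono) auto
  then show "Q * s \<le> 1 / 4" using * by (simp add: power2_eq_square)
  moreover have "1 * s \<le> Q * s" using Q s by (intro mult_right_mono) auto
  ultimately show "s \<le> 1 / 4" by simp
qed

text \<open>If the two numbers were more than \<open>2 * L\<close> apart, every point of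
  \<open>B x r\<close> would lie in one of the two exceptional sets. Together these fill at most the
  proportion \<open>s + Q * s \<le> 1 / 2\<close> of that ball.\<close>

lemma osc_close:
  assumes "x \<in> X" "y \<in> X" "0 < r" "0 < r'" "B x r \<subseteq> B y r'"
    and le: "measure \<mu> (B y r') \<le> Q * measure \<mu> (B x r)"
  shows "\<bar>c x r - c y r'\<bar> \<le> 2 * L"
proof (rule ccontr)
  assume "\<not> ?thesis"
  then have "B x r \<subseteq> {z \<in> B x r. L < \<bar>f z - c x r\<bar>} \<union> {z \<in> B y r'. L < \<bar>f z - c y r'\<bar>}"
    using assms(5) by (smt (verit) UnCI mem_Collect_eq subset_iff)
  then have "measure \<mu> (B x r) \<le>
      measure \<mu> ({z \<in> B x r. L < \<bar>f z - c x r\<bar>} \<union> {z \<in> B y r'. L < \<bar>f z - c y r'\<bar>})"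
    using assms by (intro measure_mono_fmeasurable fmeasurable.Un level_fm fmeasurableD ball_fm)
  also have "\<dots> \<le> measure \<mu> {z \<in> B x r. L < \<bar>f z - c x r\<bar>} + measure \<mu> {z \<in> B y r'. L < \<bar>f z - c y r'\<bar>}"
    using assms by (intro measure_Un_le fmeasurableD level_fm)
  also have "\<dots> \<le> s * measure \<mu> (B x r) + s * measure \<mu> (B y r')"
    using assms by (intro add_mono osc)
  also have "\<dots> \<le> s * measure \<mu> (B x r) + s * (Q * measure \<mu> (B x r))"
    using le s by (intro add_left_mono mult_left_mono) auto
  also have "\<dots> = (s + Q * s) * measure \<mu> (B x r)" by (simp add: algebra_simps)
  also have "\<dots> \<le> (1 / 2) * measure \<mu> (B x r)"
    using Qs by (intro mult_right_mono) auto
  finally show False using ball_pos[of x r] assms by simp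
qed

lemma osc_close_half:
  assumes "x \<in> X" "0 < r"
  shows "\<bar>c x (r / 2) - c x r\<bar> \<le> 2 * L"
  using assms doubling_2[of x "r / 2"] ball_mono[of "r / 2" r x] by (intro osc_close) auto

lemma osc_close_K:
  assumes "x \<in> X" "0 < r"
  shows "\<bar>c x r - c x (K * r)\<bar> \<le> 2 * L"
  using assms doubling_K[of x r] K_ge by (intro osc_close ball_mono) auto

text \<open>Both balls are compared with \<open>B x0 (K * R)\<close>, at a cost of
  \<open>2 * L\<close> each. That ball lies in \<open>B x (K * (K * R))\<close>, so the comparison
  with \<open>B x R\<close> uses doubling for two dilations.\<close>

lemma osc_close_centre:
  assumes "x0 \<in> X" "0 < R" "x \<in> B x0 R"
  shows "\<bar>c x R - c x0 R\<bar> \<le> 4 * L"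
proof -
  have x: "x \<in> X" using assms ball_subset by blast
  have "0 < K * R" using K_ge assms by simp
  have "R \<le> K * R" using K_ge assms by simp
  moreover have "d x x0 < R" using assms x sym[of x x0] by (auto simp: qball_def)
  ultimately have "d x x0 < K * R" by linarith
  then have "x0 \<in> B x (K * R)" using assms by (simp add: qball_def)
  then have "measure \<mu> (B x0 (K * R)) \<le> measure \<mu> (B x (K * (K * R)))"
    using assms x K_ge by (intro measure_mono_fmeasurable ball_K fmeasurableD ball_fm) auto
  also have "\<dots> \<le> Q * measure \<mu> (B x R)" using x assms by (intro doubling_K2)
  finally have "\<bar>c x R - c x0 (K * R)\<bar> \<le> 2 * L"
    using assms x \<open>0 < K * R\<close> by (intro osc_close ball_K) auto
  then show ?thesis using osc_close_K[of x0 R] assms by linarith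
qed

text \<open>The level rises by \<open>8 * L\<close>: at a stop the number is within
  \<open>6 * L\<close> of \<open>c x0 R\<close>, and passing to the dilated ball moves it by at most
  \<open>2 * L\<close>. Hence points of the dilate beyond level \<open>t + 8 * L\<close> are beyond
  level \<open>t\<close> for its own number, where \<open>IH\<close> applies.\<close>

lemma decay_step:
  assumes "0 \<le> q" "0 \<le> t" "x0 \<in> X" "0 < R"
    and IH: "\<And>y r. y \<in> X \<Longrightarrow> 0 < r \<Longrightarrow>
      measure \<mu> {z \<in> B y r. t < \<bar>f z - c y r\<bar>} \<le> q * measure \<mu> (B y r)"
  shows "measure \<mu> {z \<in> B x0 R. t + 8 * L < \<bar>f z - c x0 R\<bar>} \<le> q / 2 * measure \<mu> (B x0 R)"
proof -
  define W where "W = B x0 (K * R)"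
  define rr where "rr n = R / 2 ^ n" for n :: nat
  have rr: "0 < rr n" "rr 0 = R" "rr (Suc n) = rr n / 2" "rr n \<le> R" "0 < K * rr n" for n
    using \<open>0 < R\<close> K_ge by (simp_all add: rr_def field_simps)
  have KR: "0 < K * R" using \<open>0 < R\<close> K_ge by simp
  have W: "W \<in> fmeasurable \<mu>" using ball_fm KR \<open>x0 \<in> X\<close> by (simp add: W_def)
  \<comment> \<open>Pairs \<open>(x, n)\<close> at which \<open>c\<close> has just left the \<open>4 * L\<close>-neighbourhood of \<open>c x0 R\<close>; the upper bound
    \<open>6 * L\<close> holds at the first exit because halving the radius moves \<open>c\<close> by at most \<open>2 * L\<close>.\<close>
  define I where "I = {(x, n). x \<in> B x0 R \<and> 4 * L < \<bar>c x (rr n) - c x0 R\<bar> \<and>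
    \<bar>c x (rr n) - c x0 R\<bar> \<le> 6 * L}"
  have IX: "x \<in> X" if "(x, n) \<in> I" for x n using that ball_subset by (auto simp: I_def)
  have IW: "B x (rr n) \<subseteq> W" if "(x, n) \<in> I" for x n
  proof -
    have "B x (rr n) \<subseteq> B x R" using rr by (intro ball_mono)
    also have "\<dots> \<subseteq> W" unfolding W_def using that \<open>x0 \<in> X\<close> by (intro ball_K) (auto simp: I_def)
    finally show ?thesis .
  qed
  \<comment> \<open>At radius \<open>R\<close> the bound \<open>4 * L\<close> is
    \<open>osc_close_centre\<close>. One halving cannot pass \<open>6 * L\<close>, so leaving the
    \<open>4 * L\<close>-neighbourhood would put the pair into \<open>I\<close>.\<close>
  have never: "\<bar>c x (rr n) - c x0 R\<bar> \<le> 4 * L" if x: "x \<in> B x0 R" and n: "\<forall>n. (x, n) \<notin> I" for x n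
  proof (induction n)
    case 0
    show ?case using osc_close_centre assms x by (simp add: rr)
  next
    case (Suc n)
    have "x \<in> X" using x ball_subset by blast
    then have "\<bar>c x (rr (Suc n)) - c x (rr n)\<bar> \<le> 2 * L" using osc_close_half[of x "rr n"] rr(1,3) by metis
    then have "\<bar>c x (rr (Suc n)) - c x0 R\<bar> \<le> 6 * L" using Suc by linarith
    moreover have "(x, Suc n) \<notin> I" using n by blast
    ultimately show ?case using x by (auto simp: I_def)
  qed
  obtain J where J: "J \<subseteq> I" "countable J"
    "pairwise (\<lambda>(x, n) (y, k). disjnt (B x (rr n)) (B y (rr k))) J"
    "\<And>x n. (x, n) \<in> I \<Longrightarrow> \<exists>(y, k)\<in>J. x \<in> B y (K * rr k)"
    using vitali_covering[of I R W] IX IW \<open>0 < R\<close> W unfolding rr_def by blast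
  \<comment> \<open>On \<open>D j\<close> the function is within \<open>L\<close> of a number more
    than \<open>4 * L\<close> from \<open>c x0 R\<close>, which is itself within
    \<open>2 * L\<close> of \<open>c x0 (K * R)\<close>. So \<open>D j\<close> lies in
    \<open>V\<close>, and \<open>V\<close> has measure at most
    \<open>s * measure \<mu> W\<close>.\<close>
  define V where "V = {z \<in> W. L < \<bar>f z - c x0 (K * R)\<bar>}"
  define Y where "Y = (\<lambda>(x, n). {z \<in> B x (K * rr n). t < \<bar>f z - c x (K * rr n)\<bar>})"
  define D where "D = (\<lambda>(x, n). B x (rr n) - {z \<in> B x (rr n). L < \<bar>f z - c x (rr n)\<bar>})"
  define C where "C = q * Q / (1 - s)"
  have C: "0 \<le> C" using Q Qs(3) \<open>0 \<le> q\<close> by (simp add: C_def)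
  have V: "V \<in> fmeasurable \<mu>" unfolding V_def W_def using \<open>x0 \<in> X\<close> KR by (rule level_fm)
  have "(\<Union>j\<in>J. Y j) \<in> fmeasurable \<mu> \<and> measure \<mu> (\<Union>j\<in>J. Y j) \<le> C * measure \<mu> V"
  proof (rule measure_UN_le_disjoint[OF J(2) C V, of Y D])
    show "pairwise (\<lambda>i j. disjnt (D i) (D j)) J"
      using J(3) by (rule pairwise_mono) (auto simp: D_def disjnt_def)
    fix j assume "j \<in> J"
    then have "j \<in> I" using J(1) by blast
    then obtain x n where j: "j = (x, n)" and xn: "(x, n) \<in> I" by (cases j) auto
    note x = IX[OF xn]
    show "Y j \<in> fmeasurable \<mu>" unfolding Y_def j prod.case using x rr(5) by (rule level_fm)
    have fm: "B x (rr n) \<in> fmeasurable \<mu>" "{z \<in> B x (rr n). L < \<bar>f z - c x (rr n)\<bar>} \<in> fmeasurable \<mu>"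
      using x rr(1) by (rule ball_fm, rule level_fm)
    then show "D j \<in> sets \<mu>" unfolding D_def j prod.case by auto
    show "D j \<subseteq> V"
    proof
      fix z assume z: "z \<in> D j"
      have "\<bar>c x0 R - c x0 (K * R)\<bar> \<le> 2 * L" using assms by (intro osc_close_K)
      moreover have "4 * L < \<bar>c x (rr n) - c x0 R\<bar>" using xn by (simp add: I_def)
      moreover have "\<bar>f z - c x (rr n)\<bar> \<le> L" using z by (auto simp: D_def j)
      ultimately have "L < \<bar>f z - c x0 (K * R)\<bar>" by linarith
      then show "z \<in> V" using z IW[OF xn] by (auto simp: V_def D_def j)
    qed
    have "measure \<mu> (D j) = measure \<mu> (B x (rr n)) - measure \<mu> {z \<in> B x (rr n). L < \<bar>f z - c x (rr n)\<bar>}"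
      unfolding D_def j prod.case using fm by (intro measurable_measure_Diff) auto
    then have "(1 - s) * measure \<mu> (B x (rr n)) \<le> measure \<mu> (D j)"
      using osc[OF x rr(1)[of n]] by (simp add: algebra_simps)
    then have 1: "measure \<mu> (B x (rr n)) \<le> measure \<mu> (D j) / (1 - s)"
      using Qs(3) by (simp add: field_simps)
    have "measure \<mu> (Y j) \<le> q * measure \<mu> (B x (K * rr n))"
      unfolding Y_def j prod.case using x rr(5) by (rule IH)
    also have "\<dots> \<le> q * (Q * measure \<mu> (B x (rr n)))"
      using \<open>0 \<le> q\<close> x rr by (intro mult_left_mono doubling_K)
    also have "\<dots> \<le> q * (Q * (measure \<mu> (D j) / (1 - s)))"
      using \<open>0 \<le> q\<close> Q 1 by (intro mult_left_mono) auto
    also have "\<dots> = C * measure \<mu> (D j)" by (simp add: C_def)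
    finally show "measure \<mu> (Y j) \<le> C * measure \<mu> (D j)" .
  qed
  then have UY: "(\<Union>j\<in>J. Y j) \<in> fmeasurable \<mu>" "measure \<mu> (\<Union>j\<in>J. Y j) \<le> C * measure \<mu> V"
    by auto
  define A where "A = {z \<in> B x0 R. t + 8 * L < \<bar>f z - c x0 R\<bar>}"
  have A: "A \<in> fmeasurable \<mu>" unfolding A_def using assms(3,4) by (rule level_fm)
  define G where "G = A - (\<Union>j\<in>J. Y j)"
  have G: "G \<in> fmeasurable \<mu>" using A UY(1) by (auto simp: G_def intro: fmeasurable.Diff)
  \<comment> \<open>Points of \<open>G\<close> never stop, since otherwise some \<open>Y j\<close>
    would contain them. Around such a point every dyadic ball has its number within
    \<open>4 * L\<close> of \<open>c x0 R\<close>, while on \<open>G\<close> the function is more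
    than \<open>8 * L\<close> away; so \<open>G\<close> fills at most the proportion
    \<open>s\<close> of each of these balls.\<close>
  have "measure \<mu> G = 0"
  proof (rule null_if_low_density[OF G \<open>x0 \<in> X\<close> \<open>0 < R\<close>, of s])
    show "G \<subseteq> B x0 R" by (auto simp: G_def A_def)
    show "s < 1" using Qs by simp
    fix z n assume z: "z \<in> G"
    then have zB: "z \<in> B x0 R" "z \<in> X" using ball_subset by (auto simp: G_def A_def)
    have "(z, k) \<notin> I" for k
    proof
      assume "(z, k) \<in> I"
      then obtain y m where ym: "(y, m) \<in> J" "z \<in> B y (K * rr m)" using J(4) by blast
      then have yI: "(y, m) \<in> I" using J(1) by blast
      have "z \<notin> Y (y, m)" using z ym(1) by (auto simp: G_def)
      then have "\<bar>f z - c y (K * rr m)\<bar> \<le> t" using ym(2) by (auto simp: Y_def)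
      moreover have "\<bar>c y (rr m) - c y (K * rr m)\<bar> \<le> 2 * L" using IX[OF yI] rr(1) by (rule osc_close_K)
      moreover have "\<bar>c y (rr m) - c x0 R\<bar> \<le> 6 * L" using yI by (simp add: I_def)
      moreover have "t + 8 * L < \<bar>f z - c x0 R\<bar>" using z by (simp add: G_def A_def)
      ultimately show False by linarith
    qed
    then have "\<bar>c z (rr n) - c x0 R\<bar> \<le> 4 * L" using never zB by blast
    then have "G \<inter> B z (rr n) \<subseteq> {y \<in> B z (rr n). L < \<bar>f y - c z (rr n)\<bar>}"
      using L \<open>0 \<le> t\<close> by (auto simp: G_def A_def)
    then have "measure \<mu> (G \<inter> B z (rr n)) \<le> measure \<mu> {y \<in> B z (rr n). L < \<bar>f y - c z (rr n)\<bar>}"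
      using G level_fm zB rr(1) ball_fm
      by (intro measure_mono_fmeasurable) (auto intro!: sets.Int)
    also have "\<dots> \<le> s * measure \<mu> (B z (rr n))" using zB(2) rr(1) by (rule osc)
    finally show "measure \<mu> (G \<inter> B z (R / 2 ^ n)) \<le> s * measure \<mu> (B z (R / 2 ^ n))"
      by (simp add: rr_def)
  qed
  \<comment> \<open>One factor \<open>Q\<close> comes from dilating the stopped balls, the other
    from passing from \<open>W\<close> back to \<open>B x0 R\<close>. The quotient is at most 1/3,
    as \<open>Q * s * Q \<le> 1 / 4\<close> and \<open>1 - s \<ge> 3 / 4\<close>.\<close>
  have "Q * s * Q / (1 - s) \<le> 1 / 2"
    using Qs by (simp add: field_simps power2_eq_square)
  have "measure \<mu> A \<le> measure \<mu> ((\<Union>j\<in>J. Y j) \<union> G)"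
    using A G UY(1) by (intro measure_mono_fmeasurable fmeasurable.Un) (auto simp: G_def)
  also have "\<dots> \<le> measure \<mu> (\<Union>j\<in>J. Y j) + measure \<mu> G"
    using G UY(1) by (intro measure_Un_le) auto
  also have "\<dots> \<le> C * measure \<mu> V" using UY(2) \<open>measure \<mu> G = 0\<close> by simp
  also have "\<dots> \<le> C * (s * measure \<mu> W)"
    unfolding V_def W_def using C osc[OF \<open>x0 \<in> X\<close> KR] by (intro mult_left_mono)
  also have "\<dots> \<le> C * (s * (Q * measure \<mu> (B x0 R)))"
    unfolding W_def using C s assms by (intro mult_left_mono doubling_K) auto
  also have "\<dots> = (Q * s * Q / (1 - s)) * (q * measure \<mu> (B x0 R))" by (simp add: C_def)
  also have "\<dots> \<le> (1 / 2) * (q * measure \<mu> (B x0 R))"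
    using \<open>Q * s * Q / (1 - s) \<le> 1 / 2\<close> \<open>0 \<le> q\<close> by (intro mult_right_mono) auto
  finally show ?thesis by (simp add: A_def)
qed

text \<open>The induction treats all balls at once, because \<open>decay_step\<close> applies its
  hypothesis to the dilates of the stopped balls.\<close>

lemma decay:
  assumes "x \<in> X" "0 < r"
  shows "measure \<mu> {z \<in> B x r. real k * (8 * L) < \<bar>f z - c x r\<bar>} \<le> (1 / 2) ^ k * measure \<mu> (B x r)"
  using assms
proof (induction k arbitrary: x r)
  case 0
  then show ?case using ball_fm[of x r] level_fm[of x r 0 "c x r"]
    by (simp add: measure_mono_fmeasurable fmeasurableD)
next
  case (Suc k)
  have "measure \<mu> {z \<in> B x r. real k * (8 * L) + 8 * L < \<bar>f z - c x r\<bar>}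
      \<le> (1 / 2) ^ k / 2 * measure \<mu> (B x r)"
    using Suc L by (intro decay_step) auto
  moreover have "real k * (8 * L) + 8 * L = real (Suc k) * (8 * L)" by (simp add: algebra_simps)
  ultimately show ?case by (simp only:) simp
qed

text \<open>Layer-cake estimate in steps of height \<open>8 * L\<close>: the measures of the sets
  \<open>E k\<close> are dominated by a geometric series with sum 2, whence
  \<open>16 * L\<close>.\<close>

lemma ball_avg_le:
  assumes "x \<in> X" "0 < r"
  shows "ball_avg \<mu> (B x r) (\<lambda>z. \<bar>f z - c x r\<bar>) \<le> ennreal (16 * L)"
proof -
  define h where "h = 8 * L"
  define E where "E k = {z \<in> B x r. real k * h < \<bar>f z - c x r\<bar>}" for k
  have h: "0 < h" using L by (simp add: h_def)
  have E: "E k \<in> fmeasurable \<mu>" for k unfolding E_def using assms by (rule level_fm)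
  let ?m = "measure \<mu> (B x r)"
  have "(\<integral>\<^sup>+z\<in>B x r. ennreal \<bar>f z - c x r\<bar> \<partial>\<mu>) \<le> (\<integral>\<^sup>+z. (\<Sum>k. ennreal h * indicator (E k) z) \<partial>\<mu>)"
  proof (rule nn_integral_mono)
    fix z
    \<comment> \<open>Rounding up matters: \<open>z\<close> lies in \<open>E k\<close> for every
      \<open>k < n\<close>, as the inequality in \<open>E k\<close> is strict, and still
      \<open>n * h\<close> dominates the value at \<open>z\<close>.\<close>
    define n where "n = nat \<lceil>\<bar>f z - c x r\<bar> / h\<rceil>"
    show "ennreal \<bar>f z - c x r\<bar> * indicator (B x r) z \<le> (\<Sum>k. ennreal h * indicator (E k) z)"
    proof (cases "z \<in> B x r")
      case True
      have "z \<in> E k" if "k < n" for k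
      proof -
        have "real k < \<bar>f z - c x r\<bar> / h" using that unfolding n_def by linarith
        then show ?thesis using True h by (simp add: E_def field_simps)
      qed
      then have "(\<Sum>k<n. ennreal h * indicator (E k) z) = (\<Sum>k<n. ennreal h)"
        by (intro sum.cong) auto
      also have "\<dots> = ennreal (real n * h)" using h by (simp add: ennreal_mult ennreal_of_nat_eq_real_of_nat)
      finally have "ennreal (real n * h) \<le> (\<Sum>k. ennreal h * indicator (E k) z)"
        using sum_le_suminf[OF summableI, of "{..<n}" "\<lambda>k. ennreal h * indicator (E k) z"] by simp
      moreover have "\<bar>f z - c x r\<bar> / h \<le> real n" unfolding n_def by linarith
      then have "\<bar>f z - c x r\<bar> \<le> real n * h" using h by (simp add: field_simps)
      then have "ennreal \<bar>f z - c x r\<bar> \<le> ennreal (real n * h)" by (rule ennreal_leI)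
      ultimately show ?thesis using True by simp
    qed simp
  qed
  also have "\<dots> = (\<Sum>k. \<integral>\<^sup>+z. ennreal h * indicator (E k) z \<partial>\<mu>)"
    using E by (intro nn_integral_suminf) auto
  also have "\<dots> = (\<Sum>k. ennreal (h * measure \<mu> (E k)))"
    using E h by (intro suminf_cong)
      (simp add: nn_integral_cmult_indicator fmeasurableD emeasure_eq_measure2 ennreal_mult)
  also have "\<dots> \<le> (\<Sum>k. ennreal (h * ((1 / 2) ^ k * ?m)))"
    using decay[OF assms] h by (intro suminf_le summableI ennreal_leI mult_left_mono) (auto simp: E_def h_def)
  also have "\<dots> = ennreal (16 * L * ?m)"
  proof (rule suminf_ennreal_eq)
    have "(\<lambda>k. h * ?m * (1 / 2) ^ k) sums (h * ?m * (1 / (1 - 1 / 2)))"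
      by (intro sums_mult geometric_sums) simp
    then show "(\<lambda>k. h * ((1 / 2) ^ k * ?m)) sums (16 * L * ?m)" by (simp add: h_def mult_ac)
  qed (use h in simp)
  also have "\<dots> = ennreal (16 * L) * emeasure \<mu> (B x r)"
    using L ball_fm[OF assms] by (simp add: ennreal_mult emeasure_eq_measure2)
  finally have le: "(\<integral>\<^sup>+z\<in>B x r. ennreal \<bar>f z - c x r\<bar> \<partial>\<mu>) \<le> ennreal (16 * L) * emeasure \<mu> (B x r)" .
  have "0 < emeasure \<mu> (B x r)" using ball_pos[OF assms] ball_fm[OF assms] by (simp add: emeasure_eq_measure2)
  then show ?thesis unfolding ball_avg_def using le by (intro divide_le_posI_ennreal) (auto simp: mult.commute)
qed

lemma BMO_norm_le: "BMO_norm X d \<mu> f \<le> ennreal (16 * L)"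
  unfolding BMO_norm_def
proof (rule SUP_least)
  fix S assume "S \<in> qballs X d"
  then obtain x r where S: "S = B x r" "x \<in> X" "0 < r" by (auto simp: qballs_def)
  show "(INF c. ball_avg \<mu> S (\<lambda>x. \<bar>f x - c\<bar>)) \<le> ennreal (16 * L)"
    by (rule INF_lower2[of "c x r"]) (use S ball_avg_le in auto)
qed

end

subsection \<open>Comparison of the two norms\<close>

text \<open>\<open>mono_on\<close> is weak monotonicity; injectivity is what makes
  \<open>the_inv_into\<close> a true inverse. If \<open>\<phi> a = \<phi> b\<close> with
  \<open>a < b\<close>, the chord from \<open>a\<close> to a later point with a larger value would
  pass above the graph at \<open>b\<close>.\<close>

lemma concave_unbounded_inj_on:
  fixes \<phi> :: "real \<Rightarrow> real"
  assumes "concave_on {0..} \<phi>" "filterlim \<phi> at_top at_top"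
  shows "inj_on \<phi> {0..}"
proof (rule linorder_inj_onI')
  fix a b :: real assume ab: "a \<in> {0..}" "b \<in> {0..}" "a < b"
  show "\<phi> a \<noteq> \<phi> b"
  proof
    assume eq: "\<phi> a = \<phi> b"
    have "eventually (\<lambda>z. \<phi> b < \<phi> z \<and> b < z) at_top"
      using assms(2) by (intro eventually_conj eventually_gt_at_top) (simp add: filterlim_at_top_dense)
    then obtain z where z: "\<phi> b < \<phi> z" "b < z" by (auto simp: eventually_at_top_linorder)
    define t where "t = (b - a) / (z - a)"
    have t: "0 < t" "t < 1" using ab z by (auto simp: t_def)
    have "t * (z - a) = b - a" using ab z by (simp add: t_def)
    then have "(1 - t) * a + t * z = b" by (simp add: algebra_simps)
    then have "(1 - t) * \<phi> a + t * \<phi> z \<le> \<phi> b"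
      using concave_onD[OF assms(1), of t a z] t ab z by simp
    moreover have "t * \<phi> b < t * \<phi> z" using t z by simp
    ultimately show False using eq by (simp add: algebra_simps)
  qed
qed

text \<open>Evaluating the line at \<open>t0 + 1\<close>, where \<open>\<phi>\<close> has not
  decreased, gives \<open>0 \<le> m\<close>; evaluating it at 0 gives
  \<open>m * t0 \<le> \<phi> t0\<close>. The second bound later keeps the constant term of the line
  nonnegative, so that it can be split off in \<open>ennreal\<close>.\<close>

lemma concave_supporting_line:
  fixes \<phi> :: "real \<Rightarrow> real"
  assumes "concave_on {0..} \<phi>" "mono_on {0..} \<phi>" "\<phi> 0 = 0" "0 < t0"
  obtains m where "0 \<le> m" "m * t0 \<le> \<phi> t0" "\<forall>t\<ge>0. \<phi> t \<le> \<phi> t0 + m * (t - t0)"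
proof -
  have "convex_on {0..} (\<lambda>t. - \<phi> t)" using assms(1) by (simp add: concave_on_def)
  from convex_le_Inf_differential[OF this, of t0] obtain I where
    I: "\<And>t. 0 \<le> t \<Longrightarrow> - \<phi> t \<ge> - \<phi> t0 + I * (t - t0)"
    using \<open>0 < t0\<close> by auto
  have "\<phi> t0 \<le> \<phi> (t0 + 1)" using assms by (intro mono_onD[OF assms(2)]) auto
  then show thesis
    using I[of "t0 + 1"] I[of 0] I assms by (intro that[of "- I"]) (auto simp: algebra_simps)
qed

lemma le_mult_of_ball_avg_le:
  assumes "emeasure \<mu> B \<noteq> 0" "emeasure \<mu> B \<noteq> \<infinity>" "ball_avg \<mu> B g \<le> a"
  shows "(\<integral>\<^sup>+x\<in>B. ennreal (g x) \<partial>\<mu>) \<le> a * emeasure \<mu> B"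
proof -
  have "(\<integral>\<^sup>+x\<in>B. ennreal (g x) \<partial>\<mu>) = ball_avg \<mu> B g * emeasure \<mu> B"
    using assms(1,2) unfolding ball_avg_def
    by (simp add: ennreal_divide_times less_top)
  then show ?thesis using assms(3) by (simp add: mult_right_mono)
qed

section \<open>The two inequalities between the norms\<close>

context homogeneous_space
begin

lemma emeasure_ball:
  assumes "x \<in> X" "0 < r"
  shows "emeasure \<mu> (B x r) \<noteq> 0" "emeasure \<mu> (B x r) \<noteq> \<infinity>"
  using ball_pos[OF assms] ball_fm[OF assms] by (simp_all add: emeasure_eq_measure2)

text \<open>Jensen's inequality by integrating the supporting line at \<open>t0\<close>: the average
  is at most \<open>(1 - m * t0) + m / l * (l * t0) = 1\<close>.\<close>

lemma ball_avg_phi_le_1: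
  fixes \<phi> :: "real \<Rightarrow> real"
  assumes f: "f \<in> borel_measurable \<mu>" and x: "x \<in> X" "0 < r"
    and \<phi>: "concave_on {0..} \<phi>" "mono_on {0..} \<phi>" "\<phi> 0 = 0"
    and t0: "0 < t0" "\<phi> t0 = 1" and l: "0 < l"
    and avg: "ball_avg \<mu> (B x r) (\<lambda>y. \<bar>f y - a\<bar>) \<le> ennreal (l * t0)"
  shows "ball_avg \<mu> (B x r) (\<lambda>y. \<phi> (\<bar>f y - a\<bar> / l)) \<le> 1"
proof -
  obtain m where m: "0 \<le> m" "m * t0 \<le> 1" "\<forall>t\<ge>0. \<phi> t \<le> 1 + m * (t - t0)"
    using concave_supporting_line[OF \<phi> t0(1)] t0(2) by metis
  let ?B = "B x r"
  have B: "?B \<in> sets \<mu>" using ball_fm[OF x] by auto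
  have "(\<integral>\<^sup>+y\<in>?B. ennreal (\<phi> (\<bar>f y - a\<bar> / l)) \<partial>\<mu>) \<le>
      (\<integral>\<^sup>+y. ennreal (1 - m * t0) * indicator ?B y + ennreal (m / l) * (ennreal \<bar>f y - a\<bar> * indicator ?B y) \<partial>\<mu>)"
  proof (rule nn_integral_mono)
    fix y
    have "\<phi> (\<bar>f y - a\<bar> / l) \<le> 1 + m * (\<bar>f y - a\<bar> / l - t0)" using m(3) l by simp
    also have "\<dots> = (1 - m * t0) + m / l * \<bar>f y - a\<bar>" by (simp add: algebra_simps)
    finally have "ennreal (\<phi> (\<bar>f y - a\<bar> / l)) \<le> ennreal ((1 - m * t0) + m / l * \<bar>f y - a\<bar>)"
      by (rule ennreal_leI)
    also have "\<dots> = ennreal (1 - m * t0) + ennreal (m / l) * ennreal \<bar>f y - a\<bar>"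
      using m l by (simp add: ennreal_plus ennreal_mult del: times_divide_eq_left)
    finally show "ennreal (\<phi> (\<bar>f y - a\<bar> / l)) * indicator ?B y \<le>
      ennreal (1 - m * t0) * indicator ?B y + ennreal (m / l) * (ennreal \<bar>f y - a\<bar> * indicator ?B y)"
      by (auto simp: indicator_def)
  qed
  also have "\<dots> = ennreal (1 - m * t0) * emeasure \<mu> ?B + ennreal (m / l) * (\<integral>\<^sup>+y\<in>?B. ennreal \<bar>f y - a\<bar> \<partial>\<mu>)"
    using f B by (simp add: nn_integral_add nn_integral_cmult nn_integral_cmult_indicator)
  also have "\<dots> \<le> ennreal (1 - m * t0) * emeasure \<mu> ?B + ennreal (m / l) * (ennreal (l * t0) * emeasure \<mu> ?B)"
    using le_mult_of_ball_avg_le[OF emeasure_ball[OF x] avg] by (intro add_left_mono mult_left_mono) auto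
  also have "\<dots> = (ennreal (1 - m * t0) + ennreal (m / l * (l * t0))) * emeasure \<mu> ?B"
    using m l t0 by (subst ennreal_mult[of "m / l"]) (simp_all add: distrib_right mult.assoc)
  also have "ennreal (1 - m * t0) + ennreal (m / l * (l * t0)) = 1"
    using m l t0 by (simp flip: ennreal_plus)
  finally show ?thesis
    unfolding ball_avg_def using emeasure_ball[OF x] by (intro divide_le_posI_ennreal) (auto simp: zero_less_iff_neq_zero)
qed

lemma BMO_phi_norm_le:
  fixes \<phi> :: "real \<Rightarrow> real"
  assumes f: "f \<in> borel_measurable \<mu>"
    and \<phi>: "concave_on {0..} \<phi>" "mono_on {0..} \<phi>" "\<phi> 0 = 0" and t0: "0 < t0" "\<phi> t0 = 1"
  shows "ennreal t0 * BMO_phi_norm \<phi> X d \<mu> f \<le> BMO_norm X d \<mu> f"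
proof -
  have *: "ennreal t0 * (INF c. Inf {ennreal l |l. 0 < l \<and> ball_avg \<mu> S (\<lambda>x. \<phi> (\<bar>f x - c\<bar> / l)) \<le> 1})
      \<le> (INF c. ball_avg \<mu> S (\<lambda>x. \<bar>f x - c\<bar>))" if "S \<in> qballs X d" for S
  proof (rule INF_greatest)
    fix c
    obtain x r where S: "S = B x r" and x: "x \<in> X" "0 < r" using \<open>S \<in> qballs X d\<close> by (auto simp: qballs_def)
    let ?I = "\<lambda>c. Inf {ennreal l |l. 0 < l \<and> ball_avg \<mu> S (\<lambda>x. \<phi> (\<bar>f x - c\<bar> / l)) \<le> 1}"
    show "ennreal t0 * (INF c. ?I c) \<le> ball_avg \<mu> S (\<lambda>x. \<bar>f x - c\<bar>)"
    proof (rule ennreal_le_epsilon)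
      fix e :: real assume fin: "ball_avg \<mu> S (\<lambda>x. \<bar>f x - c\<bar>) < top" and e: "0 < e"
      then obtain a where a: "0 \<le> a" "ball_avg \<mu> S (\<lambda>x. \<bar>f x - c\<bar>) = ennreal a"
        by (metis ennreal_cases top.not_eq_extremum)
      \<comment> \<open>The slack \<open>e\<close> keeps \<open>l\<close> positive even when the
        average \<open>a\<close> vanishes.\<close>
      define l where "l = (a + e) / t0"
      have l: "0 < l" "l * t0 = a + e" using a e t0 by (auto simp: l_def)
      have "ball_avg \<mu> S (\<lambda>x. \<phi> (\<bar>f x - c\<bar> / l)) \<le> 1"
        unfolding S
      proof (rule ball_avg_phi_le_1[OF f x \<phi> t0 l(1)])
        show "ball_avg \<mu> (B x r) (\<lambda>y. \<bar>f y - c\<bar>) \<le> ennreal (l * t0)"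
          using a e by (simp add: l(2) S)
      qed
      then have "?I c \<le> ennreal l" using l by (intro Inf_lower) auto
      then have "(INF c. ?I c) \<le> ennreal l" by (rule INF_lower2[OF UNIV_I])
      then have "ennreal t0 * (INF c. ?I c) \<le> ennreal t0 * ennreal l" by (intro mult_left_mono) auto
      also have "\<dots> = ennreal (a + e)" using l t0 by (simp add: mult.commute flip: ennreal_mult)
      also have "\<dots> = ball_avg \<mu> S (\<lambda>x. \<bar>f x - c\<bar>) + ennreal e" using a e by (simp add: ennreal_plus)
      finally show "ennreal t0 * (INF c. ?I c) \<le> ball_avg \<mu> S (\<lambda>x. \<bar>f x - c\<bar>) + ennreal e" .
    qed
  qed
  show ?thesis
    unfolding BMO_phi_norm_def BMO_norm_def SUP_mult_left_ennreal
    using * by (intro SUP_mono) auto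
qed

text \<open>Chebyshev's inequality: on the level set the argument of \<open>\<phi>\<close> is at
  least \<open>t\<close>, because \<open>l \<le> u\<close>. Using \<open>u\<close> in the level lets
  a single bound \<open>t * u\<close> serve all balls, although \<open>a\<close> and
  \<open>l\<close> vary with the ball.\<close>

lemma measure_level_le:
  fixes \<phi> :: "real \<Rightarrow> real"
  assumes f: "f \<in> borel_measurable \<mu>" and x: "x \<in> X" "0 < r"
    and \<phi>: "mono_on {0..} \<phi>" and t: "0 < t" "1 \<le> s * \<phi> t" "0 < s" and l: "0 < l" "l \<le> u"
    and avg: "ball_avg \<mu> (B x r) (\<lambda>y. \<phi> (\<bar>f y - a\<bar> / l)) \<le> 1"
  shows "measure \<mu> {y \<in> B x r. t * u < \<bar>f y - a\<bar>} \<le> s * measure \<mu> (B x r)"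
proof -
  let ?E = "{y \<in> B x r. t * u < \<bar>f y - a\<bar>}"
  have "{y \<in> space \<mu>. t * u < \<bar>f y - a\<bar>} \<in> sets \<mu>" using f by measurable
  moreover have "?E = B x r \<inter> {y \<in> space \<mu>. t * u < \<bar>f y - a\<bar>}"
    using ball_subset by (auto simp: space_eq)
  ultimately have E: "?E \<in> fmeasurable \<mu>" using fmeasurable_Int_fmeasurable[OF ball_fm[OF x]] by simp
  have pos: "0 < \<phi> t" using t by (smt (verit) zero_less_mult_iff)
  have "ennreal (\<phi> t) * emeasure \<mu> ?E = (\<integral>\<^sup>+y. ennreal (\<phi> t) * indicator ?E y \<partial>\<mu>)"
    using E by (simp add: nn_integral_cmult_indicator fmeasurableD)
  also have "\<dots> \<le> (\<integral>\<^sup>+y\<in>B x r. ennreal (\<phi> (\<bar>f y - a\<bar> / l)) \<partial>\<mu>)"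
  proof (rule nn_integral_mono)
    fix y
    show "ennreal (\<phi> t) * indicator ?E y \<le> ennreal (\<phi> (\<bar>f y - a\<bar> / l)) * indicator (B x r) y"
    proof (cases "y \<in> ?E")
      case True
      have "t * l \<le> t * u" using t l by simp
      then have "t \<le> \<bar>f y - a\<bar> / l" using True l by (simp add: field_simps)
      then have "\<phi> t \<le> \<phi> (\<bar>f y - a\<bar> / l)" using t by (intro mono_onD[OF \<phi>]) auto
      then show ?thesis using True by (auto intro: ennreal_leI)
    qed simp
  qed
  also have "\<dots> \<le> 1 * emeasure \<mu> (B x r)" by (rule le_mult_of_ball_avg_le[OF emeasure_ball[OF x] avg])
  finally have "\<phi> t * measure \<mu> ?E \<le> measure \<mu> (B x r)"
    using pos E ball_fm[OF x] by (simp add: emeasure_eq_measure2 flip: ennreal_mult)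
  then have "s * (\<phi> t * measure \<mu> ?E) \<le> s * measure \<mu> (B x r)" using t by (intro mult_left_mono) auto
  moreover have "1 * measure \<mu> ?E \<le> s * \<phi> t * measure \<mu> ?E" using t by (intro mult_right_mono) auto
  ultimately show ?thesis by (simp add: mult.assoc)
qed

lemma BMO_norm_le_phi:
  fixes \<phi> :: "real \<Rightarrow> real"
  assumes f: "f \<in> borel_measurable \<mu>" and \<phi>: "mono_on {0..} \<phi>"
    and t: "0 < t" "4 * Q\<^sup>2 \<le> \<phi> t"
  shows "BMO_norm X d \<mu> f \<le> ennreal (16 * t) * BMO_phi_norm \<phi> X d \<mu> f"
proof -
  define N where "N = BMO_phi_norm \<phi> X d \<mu> f"
  define s where "s = 1 / (4 * Q\<^sup>2)"
  have s: "0 < s" "4 * Q\<^sup>2 * s = 1" "1 \<le> s * \<phi> t" using Q t by (auto simp: s_def field_simps)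
  \<comment> \<open>Since \<open>u\<close> lies strictly above the norm, every ball has an
    admissible pair of a number and a scale below \<open>u\<close>. Choosing one number per ball
    gives an instance of \<open>small_oscillation\<close> with bound \<open>t * u\<close>.\<close>
  have le: "BMO_norm X d \<mu> f \<le> ennreal (16 * (t * u))" if u: "0 < u" "N < ennreal u" for u
  proof -
    have "\<exists>c. measure \<mu> {y \<in> B x r. t * u < \<bar>f y - c\<bar>} \<le> s * measure \<mu> (B x r)"
      if x: "x \<in> X" "0 < r" for x r
    proof -
      have "(INF c. Inf {ennreal l |l. 0 < l \<and> ball_avg \<mu> (B x r) (\<lambda>x. \<phi> (\<bar>f x - c\<bar> / l)) \<le> 1}) \<le> N"
        unfolding N_def BMO_phi_norm_def by (rule SUP_upper) (use x in \<open>auto simp: qballs_def\<close>)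
      also note u(2)
      finally obtain c l where cl: "0 < l" "ball_avg \<mu> (B x r) (\<lambda>x. \<phi> (\<bar>f x - c\<bar> / l)) \<le> 1" "ennreal l < ennreal u"
        by (auto simp: INF_less_iff Inf_less_iff)
      then have "l \<le> u" using u by (simp add: ennreal_less_iff)
      then show ?thesis using measure_level_le[OF f x \<phi> t(1) s(3,1) cl(1) _ cl(2)] by blast
    qed
    then obtain c where c: "\<And>x r. x \<in> X \<Longrightarrow> 0 < r \<Longrightarrow>
        measure \<mu> {y \<in> B x r. t * u < \<bar>f y - c x r\<bar>} \<le> s * measure \<mu> (B x r)" by metis
    interpret small_oscillation X d \<mu> \<kappa> Q f s "t * u" c
      using f t u s c by unfold_locales auto
    show ?thesis by (rule BMO_norm_le)
  qed
  show ?thesis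
  proof (cases "N = top")
    case True
    then show ?thesis using t by (simp add: N_def ennreal_mult_top)
  next
    case False
    then obtain n where n: "0 \<le> n" "N = ennreal n" by (metis ennreal_cases)
    have eps: "BMO_norm X d \<mu> f \<le> ennreal (16 * t * n) + ennreal e" if "0 < e" for e
    proof -
      have "BMO_norm X d \<mu> f \<le> ennreal (16 * (t * (n + e / (16 * t))))"
        using that n t by (intro le) (auto simp: ennreal_less_iff intro!: add_nonneg_pos)
      also have "16 * (t * (n + e / (16 * t))) = 16 * t * n + e" using t by (simp add: field_simps)
      finally show ?thesis using that t n by (simp add: ennreal_plus)
    qed
    have "BMO_norm X d \<mu> f \<le> ennreal (16 * t * n)" by (rule ennreal_le_epsilon) (rule eps)
    then show ?thesis using n(1) t unfolding N_def[symmetric] n(2) by (simp flip: ennreal_mult)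
  qed
qed

end

text \<open>Doubling is iterated until \<open>2 ^ n\<close> exceeds the required dilation. Replacing
  the doubling constant by its maximum with 1 ensures \<open>1 \<le> Q\<close>.\<close>

lemma homogeneous_space_of:
  assumes "space_of_homogeneous_type X d \<mu>"
  obtains \<kappa> Q where "homogeneous_space X d \<mu> \<kappa> Q"
proof -
  have qm: "quasi_metric_on X d" and sp: "space \<mu> = X"
    and st: "sets \<mu> = sigma_sets X {U. openin (qtopology X d) U}"
    and ball: "\<And>x r. x \<in> X \<Longrightarrow> 0 < r \<Longrightarrow> qball X d x r \<in> sets \<mu> \<and>
        0 < emeasure \<mu> (qball X d x r) \<and> emeasure \<mu> (qball X d x r) < \<infinity>"
    using assms by (auto simp: space_of_homogeneous_type_def)
  obtain c where c: "0 < c" "\<And>x r. x \<in> X \<Longrightarrow> 0 < r \<Longrightarrow>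
      emeasure \<mu> (qball X d x (2 * r)) \<le> ennreal c * emeasure \<mu> (qball X d x r)"
    using assms unfolding space_of_homogeneous_type_def by blast
  have "\<exists>\<kappa>\<ge>1. \<forall>x\<in>X. \<forall>y\<in>X. \<forall>z\<in>X. d x y \<le> \<kappa> * (d x z + d z y)"
    using qm unfolding quasi_metric_on_def by (elim conjE)
  then obtain \<kappa> where \<kappa>: "1 \<le> \<kappa>" "\<And>x y z. x \<in> X \<Longrightarrow> y \<in> X \<Longrightarrow> z \<in> X \<Longrightarrow> d x y \<le> \<kappa> * (d x z + d z y)"
    by blast
  have fm: "qball X d x r \<in> fmeasurable \<mu>" "0 < measure \<mu> (qball X d x r)" if "x \<in> X" "0 < r" for x r
  proof -
    show "qball X d x r \<in> fmeasurable \<mu>" using ball[OF that] by (auto intro: fmeasurableI)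
    then show "0 < measure \<mu> (qball X d x r)" using ball[OF that] by (simp add: emeasure_eq_measure2)
  qed
  define b where "b = max 1 c"
  have dbl: "measure \<mu> (qball X d x (2 * r)) \<le> b * measure \<mu> (qball X d x r)" if "x \<in> X" "0 < r" for x r
  proof -
    have "measure \<mu> (qball X d x (2 * r)) \<le> c * measure \<mu> (qball X d x r)"
    proof -
      have "ennreal (measure \<mu> (qball X d x (2 * r))) \<le> ennreal c * ennreal (measure \<mu> (qball X d x r))"
        using c(2)[OF that] fm(1)[of x r] fm(1)[of x "2 * r"] that by (simp add: emeasure_eq_measure2)
      also have "\<dots> = ennreal (c * measure \<mu> (qball X d x r))" using c(1) by (simp add: ennreal_mult)
      finally show ?thesis using c(1) by simp
    qed
    also have "\<dots> \<le> b * measure \<mu> (qball X d x r)" unfolding b_def by (intro mult_right_mono) auto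
    finally show ?thesis .
  qed
  have pow: "measure \<mu> (qball X d x (2 ^ n * r)) \<le> b ^ n * measure \<mu> (qball X d x r)"
    if "x \<in> X" "0 < r" for x r n
  proof (induction n)
    case (Suc n)
    have "measure \<mu> (qball X d x (2 * (2 ^ n * r))) \<le> b * measure \<mu> (qball X d x (2 ^ n * r))"
      using that by (intro dbl) auto
    also have "\<dots> \<le> b * (b ^ n * measure \<mu> (qball X d x r))"
      using Suc by (intro mult_left_mono) (auto simp: b_def)
    finally show ?case by (simp add: mult.assoc)
  qed simp
  obtain n where n: "(3 * \<kappa>\<^sup>2)\<^sup>2 < 2 ^ n" using real_arch_pow[of 2] by auto
  have "homogeneous_space X d \<mu> \<kappa> (b ^ n)"
  proof
    fix x r assume x: "x \<in> X" "0 < (r::real)"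
    have "measure \<mu> (qball X d x ((3 * \<kappa>\<^sup>2)\<^sup>2 * r)) \<le> measure \<mu> (qball X d x (2 ^ n * r))"
    proof (rule measure_mono_fmeasurable)
      have "(3 * \<kappa>\<^sup>2)\<^sup>2 * r \<le> 2 ^ n * r" using n x by (intro mult_right_mono) auto
      then show "qball X d x ((3 * \<kappa>\<^sup>2)\<^sup>2 * r) \<subseteq> qball X d x (2 ^ n * r)"
        by (auto simp: qball_def)
    qed (use fm x \<kappa>(1) in \<open>auto intro!: fmeasurableD\<close>)
    also have "\<dots> \<le> b ^ n * measure \<mu> (qball X d x r)" by (rule pow[OF x])
    finally show "measure \<mu> (qball X d x ((3 * \<kappa>\<^sup>2)\<^sup>2 * r)) \<le> b ^ n * measure \<mu> (qball X d x r)" .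
  qed (use qm sp st fm \<kappa> in \<open>auto simp: quasi_metric_on_def b_def one_le_power\<close>)
  then show thesis by (rule that)
qed

theorem theorem1p4:
  fixes X :: "'a set" and d :: "'a \<Rightarrow> 'a \<Rightarrow> real" and \<mu> :: "'a measure"
    and \<phi> :: "real \<Rightarrow> real"
  assumes "space_of_homogeneous_type X d \<mu>"
    and "\<phi> \<in> {0..} \<rightarrow> {0..}"
    and "mono_on {0..} \<phi>"
    and "continuous_on {0..} \<phi>"
    and "concave_on {0..} \<phi>"
    and "\<phi> 0 = 0"
    and "filterlim \<phi> at_top at_top"
  shows "BMO X d \<mu> = BMO_phi \<phi> X d \<mu> \<and>
    (\<exists>c::real. 0 < c \<and> (\<forall>f \<in> borel_measurable \<mu>.
       ennreal (the_inv_into {0..} \<phi> 1) * BMO_phi_norm \<phi> X d \<mu> f \<le> BMO_norm X d \<mu> f \<and>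
       BMO_norm X d \<mu> f \<le> ennreal c * BMO_phi_norm \<phi> X d \<mu> f))"
proof -
  obtain \<kappa> Q where "homogeneous_space X d \<mu> \<kappa> Q"
    using homogeneous_space_of[OF assms(1)] by blast
  then interpret homogeneous_space X d \<mu> \<kappa> Q .
  have large: "\<exists>t>0. y \<le> \<phi> t" for y
  proof -
    have "eventually (\<lambda>t. y \<le> \<phi> t \<and> 0 < t) at_top"
      using assms(7) by (intro eventually_conj eventually_gt_at_top) (simp add: filterlim_at_top)
    then show ?thesis by (auto simp: eventually_at_top_linorder)
  qed
  obtain b where b: "0 < b" "1 \<le> \<phi> b" using large by blast
  have "continuous_on {0..b} \<phi>" using assms(4) by (rule continuous_on_subset) auto
  then obtain t0 where t0: "0 \<le> t0" "\<phi> t0 = 1"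
    using IVT'[of \<phi> 0 1 b] assms(6) b by auto
  then have "0 < t0" using assms(6) by (cases "t0 = 0") auto
  have inv: "the_inv_into {0..} \<phi> 1 = t0"
    using the_inv_into_f_f[OF concave_unbounded_inj_on[OF assms(5,7)], of t0] t0 by simp
  \<comment> \<open>The choice involves only \<open>\<phi>\<close> and \<open>Q\<close>, so the
    final constant \<open>16 * t\<close> is independent of \<open>f\<close>.\<close>
  obtain t where t: "0 < t" "4 * Q\<^sup>2 \<le> \<phi> t" using large by blast
  have lower: "ennreal t0 * BMO_phi_norm \<phi> X d \<mu> f \<le> BMO_norm X d \<mu> f"
    and upper: "BMO_norm X d \<mu> f \<le> ennreal (16 * t) * BMO_phi_norm \<phi> X d \<mu> f"
    if "f \<in> borel_measurable \<mu>" for f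
    using BMO_phi_norm_le[OF that assms(5,3,6) \<open>0 < t0\<close> t0(2)] BMO_norm_le_phi[OF that assms(3) t] by auto
  have "BMO_norm X d \<mu> f < \<infinity> \<longleftrightarrow> BMO_phi_norm \<phi> X d \<mu> f < \<infinity>" if "f \<in> borel_measurable \<mu>" for f
  proof
    assume "BMO_norm X d \<mu> f < \<infinity>"
    then have "ennreal t0 * BMO_phi_norm \<phi> X d \<mu> f < top"
      using lower[OF that] by (auto intro: le_less_trans)
    then show "BMO_phi_norm \<phi> X d \<mu> f < \<infinity>"
      using \<open>0 < t0\<close> by (auto simp: ennreal_mult_less_top)
  next
    assume "BMO_phi_norm \<phi> X d \<mu> f < \<infinity>"
    then have "ennreal (16 * t) * BMO_phi_norm \<phi> X d \<mu> f < top" by (simp add: ennreal_mult_less_top)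
    then show "BMO_norm X d \<mu> f < \<infinity>" using upper[OF that] by (auto intro: le_less_trans)
  qed
  then have "BMO X d \<mu> = BMO_phi \<phi> X d \<mu>" by (auto simp: BMO_def BMO_phi_def)
  moreover have "0 < 16 * t" using t by simp
  ultimately show ?thesis using lower upper unfolding inv by blast
qed

end
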